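(* Let $E$ and $F$ be two Banach spaces, let $p\in[1,\infty]$, let $T:F\to E$ be a bounded linear operator, and let $\overline{T}:\operatorname{FBL}^{(p)}[F]\to\operatorname{FBL}^{(p)}[E]$ be the associated lattice homomorphism. Then $T$ is injective if and only if $\overline{T}$ is injective.
   Context: Banach spaces are real. For a Banach space $E$ with dual $E^{*}$ and closed unit ball $B_E$, $H[E]$ denotes the vector lattice (pointwise operations and order) of all positively homogeneous functions $f:E^{*}\to\mathbb{R}$, i.e. $f(\lambda x^{*})=\lambda f(x^{*})$ for all $\lambda\ge 0$, $x^{*}\in E^{*}$. For $x\in E$ let $\delta_x\in H[E]$ be $\delta_x(x^{*})=x^{*}(x)$, and let $\delta_E(x)=\delta_x$. For $1\le p<\infty$ and $f\in H[E]$ put $$\|f\|_{\operatorname{FBL}^{(p)}[E]}=\sup\Big\{\Big(\sum_k|f(x_k^{*})|^p\Big)^{1/p}\Big\},$$ the supremum being over all finite sequences $(x_k^{*})$ in $E^{*}$ with $\sum_k|x_k^{*}(x)|^p\le 1$ for all $x\in B_E$; for $p=\infty$ put $\|f\|_{\operatorname{FBL}^{(\infty)}[E]}=\sup_{x^{*}\in B_{E^{*}}}|f(x^{*})|$. Let $H^{p}[E]=\{f\in H[E]:\|f\|_{\operatorname{FBL}^{(p)}[E]}<\infty\}$, a Banach lattice. The free $p$-convex Banach lattice $\operatorname{FBL}^{(p)}[E]$ is the norm-closed sublattice of $H^{p}[E]$ generated by $\delta_E(E)$. For a bounded linear operator $T:F\to E$, $\overline{T}:\operatorname{FBL}^{(p)}[F]\to\operatorname{FBL}^{(p)}[E]$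 is the unique (bounded) lattice homomorphism with $\overline{T}\circ\delta_F=\delta_E\circ T$; it is given by $\overline{T}f=f\circ T^{*}$, where $T^{*}:E^{*}\to F^{*}$ is the adjoint of $T$. *)

theory Defs
  imports "HOL-Analysis.Analysis"
begin

text \<open>The dual of \<open>E\<close> is the type \<open>'e \<Rightarrow>\<^sub>L real\<close> of bounded linear functionals.\<close>

definition pos_homogeneous :: "(('e::real_normed_vector \<Rightarrow>\<^sub>L real) \<Rightarrow> real) set" where
  "pos_homogeneous = {f. \<forall>c\<ge>0. \<forall>\<phi>. f (c *\<^sub>R \<phi>) = c * f \<phi>}"

definition fbl_delta :: "'e::real_normed_vector \<Rightarrow> ('e \<Rightarrow>\<^sub>L real) \<Rightarrow> real" where
  "fbl_delta x = (\<lambda>\<phi>. blinfun_apply \<phi> x)"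

definition fbl_admissible :: "real \<Rightarrow> ('e::real_normed_vector \<Rightarrow>\<^sub>L real) list set" where
  "fbl_admissible r = {\<phi>s. \<forall>x\<in>cball 0 1. (\<Sum>\<phi>\<leftarrow>\<phi>s. \<bar>blinfun_apply \<phi> x\<bar> powr r) \<le> 1}"

definition fbl_norm :: "ennreal \<Rightarrow> (('e::real_normed_vector \<Rightarrow>\<^sub>L real) \<Rightarrow> real) \<Rightarrow> ennreal" where
  "fbl_norm p f =
    (if p = \<infinity> then (SUP \<phi>\<in>cball 0 1. ennreal \<bar>f \<phi>\<bar>)
     else (SUP \<phi>s\<in>fbl_admissible (enn2real p).
             ennreal ((\<Sum>\<phi>\<leftarrow>\<phi>s. \<bar>f \<phi>\<bar> powr enn2real p) powr (1 / enn2real p))))"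

definition fbl_H :: "ennreal \<Rightarrow> (('e::real_normed_vector \<Rightarrow>\<^sub>L real) \<Rightarrow> real) set" where
  "fbl_H p = {f \<in> pos_homogeneous. fbl_norm p f < \<infinity>}"

definition fbl_closed_sublattice ::
    "ennreal \<Rightarrow> (('e::real_normed_vector \<Rightarrow>\<^sub>L real) \<Rightarrow> real) set \<Rightarrow> bool" where
  "fbl_closed_sublattice p L \<longleftrightarrow>
     L \<subseteq> fbl_H p \<and> (\<lambda>\<phi>. 0) \<in> L \<and>
     (\<forall>f\<in>L. \<forall>g\<in>L. (\<lambda>\<phi>. f \<phi> + g \<phi>) \<in> L) \<and>
     (\<forall>c. \<forall>f\<in>L. (\<lambda>\<phi>. c * f \<phi>) \<in> L) \<and>
     (\<forall>f\<in>L. \<forall>g\<in>L. (\<lambda>\<phi>. max (f \<phi>) (g \<phi>)) \<in> L \<and> (\<lambda>\<phi>. min (f \<phi>) (g \<phi>)) \<in> L) \<and>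
     (\<forall>f\<in>fbl_H p. (\<forall>e>0. \<exists>g\<in>L. fbl_norm p (\<lambda>\<phi>. f \<phi> - g \<phi>) < ennreal e) \<longrightarrow> f \<in> L)"

definition FBL :: "ennreal \<Rightarrow> (('e::real_normed_vector \<Rightarrow>\<^sub>L real) \<Rightarrow> real) set" where
  "FBL p = \<Inter> {L. fbl_closed_sublattice p L \<and> range fbl_delta \<subseteq> L}"

definition fbl_lattice_hom ::
    "ennreal \<Rightarrow> ((('f::real_normed_vector \<Rightarrow>\<^sub>L real) \<Rightarrow> real) \<Rightarrow>
      (('e::real_normed_vector \<Rightarrow>\<^sub>L real) \<Rightarrow> real)) \<Rightarrow> bool" where
  "fbl_lattice_hom p S \<longleftrightarrow>
     S \<in> FBL p \<rightarrow> FBL p \<and>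
     (\<forall>f\<in>FBL p. \<forall>g\<in>FBL p. S (\<lambda>\<psi>. f \<psi> + g \<psi>) = (\<lambda>\<phi>. S f \<phi> + S g \<phi>)) \<and>
     (\<forall>c. \<forall>f\<in>FBL p. S (\<lambda>\<psi>. c * f \<psi>) = (\<lambda>\<phi>. c * S f \<phi>)) \<and>
     (\<forall>f\<in>FBL p. \<forall>g\<in>FBL p.
        S (\<lambda>\<psi>. max (f \<psi>) (g \<psi>)) = (\<lambda>\<phi>. max (S f \<phi>) (S g \<phi>)) \<and>
        S (\<lambda>\<psi>. min (f \<psi>) (g \<psi>)) = (\<lambda>\<phi>. min (S f \<phi>) (S g \<phi>)))"

definition fbl_bounded ::
    "ennreal \<Rightarrow> ((('f::real_normed_vector \<Rightarrow>\<^sub>L real) \<Rightarrow> real) \<Rightarrow>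
      (('e::real_normed_vector \<Rightarrow>\<^sub>L real) \<Rightarrow> real)) \<Rightarrow> bool" where
  "fbl_bounded p S \<longleftrightarrow> (\<exists>C. \<forall>f\<in>FBL p. fbl_norm p (S f) \<le> ennreal C * fbl_norm p f)"

text \<open>Maps on \<open>FBL p\<close> are total functions, so the extension is unique only once its values
  outside \<open>FBL p\<close> are fixed; this is what \<open>extensional\<close> is for. Existence and uniqueness
  are \<open>fbl_ext_unique\<close>, and the formula \<open>f \<circ> T\<^sup>*\<close> is \<open>fbl_ext_apply\<close>, both below.\<close>

definition fbl_ext ::
    "ennreal \<Rightarrow> ('f::banach \<Rightarrow>\<^sub>L 'e::banach) \<Rightarrow>
      (('f \<Rightarrow>\<^sub>L real) \<Rightarrow> real) \<Rightarrow> (('e \<Rightarrow>\<^sub>L real) \<Rightarrow> real)" where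
  "fbl_ext p T = (THE S. S \<in> extensional (FBL p) \<and> fbl_lattice_hom p S \<and> fbl_bounded p S \<and>
     (\<forall>x. S (fbl_delta x) = fbl_delta (blinfun_apply T x)))"

lemma fbl_closed_sublatticeD:
  assumes "fbl_closed_sublattice p L"
  shows "L \<subseteq> fbl_H p" "(\<lambda>\<phi>. 0) \<in> L"
    and "f \<in> L \<Longrightarrow> g \<in> L \<Longrightarrow> (\<lambda>\<phi>. f \<phi> + g \<phi>) \<in> L"
    and "f \<in> L \<Longrightarrow> (\<lambda>\<phi>. c * f \<phi>) \<in> L"
    and "f \<in> L \<Longrightarrow> g \<in> L \<Longrightarrow> (\<lambda>\<phi>. max (f \<phi>) (g \<phi>)) \<in> L"
    and "f \<in> L \<Longrightarrow> g \<in> L \<Longrightarrow> (\<lambda>\<phi>. min (f \<phi>) (g \<phi>)) \<in> L"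
    and "f \<in> fbl_H p \<Longrightarrow> (\<And>e. e > 0 \<Longrightarrow> \<exists>g\<in>L. fbl_norm p (\<lambda>\<phi>. f \<phi> - g \<phi>) < ennreal e) \<Longrightarrow> f \<in> L"
  using assms unfolding fbl_closed_sublattice_def by simp_all

lemma fbl_lattice_homD:
  assumes "fbl_lattice_hom p S"
  shows "f \<in> FBL p \<Longrightarrow> S f \<in> FBL p"
    and "f \<in> FBL p \<Longrightarrow> g \<in> FBL p \<Longrightarrow> S (\<lambda>\<psi>. f \<psi> + g \<psi>) = (\<lambda>\<phi>. S f \<phi> + S g \<phi>)"
    and "f \<in> FBL p \<Longrightarrow> S (\<lambda>\<psi>. c * f \<psi>) = (\<lambda>\<phi>. c * S f \<phi>)"
    and "f \<in> FBL p \<Longrightarrow> g \<in> FBL p \<Longrightarrow>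
      S (\<lambda>\<psi>. max (f \<psi>) (g \<psi>)) = (\<lambda>\<phi>. max (S f \<phi>) (S g \<phi>))"
    and "f \<in> FBL p \<Longrightarrow> g \<in> FBL p \<Longrightarrow>
      S (\<lambda>\<psi>. min (f \<psi>) (g \<psi>)) = (\<lambda>\<phi>. min (S f \<phi>) (S g \<phi>))"
  using assms unfolding fbl_lattice_hom_def by (simp_all add: Pi_iff)

lemma fbl_p_cases:
  assumes "1 \<le> (p::ennreal)"
  obtains "p = \<infinity>" | "p \<noteq> \<infinity>" "1 \<le> enn2real p"
proof (cases "p = \<infinity>")
  case False
  then have "ennreal (enn2real p) = p" by (simp add: less_top)
  then have "1 \<le> enn2real p" using assms
    by (metis enn2real_nonneg ennreal_1 ennreal_le_iff)
  then show ?thesis using False that by blast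
qed (use that in blast)

lemma fbl_norm_le_iff:
  assumes "1 \<le> p" "0 \<le> C"
  shows "fbl_norm p f \<le> ennreal C \<longleftrightarrow>
    (if p = \<infinity> then \<forall>\<phi>\<in>cball 0 1. \<bar>f \<phi>\<bar> \<le> C
     else \<forall>\<phi>s\<in>fbl_admissible (enn2real p).
       (\<Sum>\<phi>\<leftarrow>\<phi>s. \<bar>f \<phi>\<bar> powr enn2real p) \<le> C powr enn2real p)"
proof (cases rule: fbl_p_cases[OF assms(1)])
  case 1
  then show ?thesis using assms by (simp add: fbl_norm_def SUP_le_iff)
next
  case 2
  define r where "r = enn2real p"
  have r: "1 \<le> r" using 2 by (simp add: r_def)
  have "s powr (1/r) \<le> C \<longleftrightarrow> s \<le> C powr r" if "0 \<le> s" for s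
  proof
    assume "s powr (1/r) \<le> C"
    then have "(s powr (1/r)) powr r \<le> C powr r" using r by (intro powr_mono2) auto
    then show "s \<le> C powr r" using r that by (simp add: powr_powr)
  next
    assume "s \<le> C powr r"
    then have "s powr (1/r) \<le> (C powr r) powr (1/r)" using r that by (intro powr_mono2) auto
    then show "s powr (1/r) \<le> C" using r assms by (simp add: powr_powr)
  qed
  moreover have "0 \<le> (\<Sum>\<phi>\<leftarrow>\<phi>s. \<bar>f \<phi>\<bar> powr r)" for \<phi>s by (rule sum_list_nonneg) auto
  ultimately show ?thesis using 2 assms unfolding r_def
    by (simp add: fbl_norm_def SUP_le_iff)
qed

lemma fbl_norm_finiteE:
  assumes "fbl_norm p f < \<infinity>"
  obtains C where "0 \<le> C" "fbl_norm p f = ennreal C"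
  using assms by (cases "fbl_norm p f") auto

lemma fbl_norm_dominated:
  assumes p: "1 \<le> p" and c: "0 \<le> c" and h: "\<And>\<phi>. \<bar>h \<phi>\<bar> \<le> c * (\<bar>f \<phi>\<bar> + \<bar>g \<phi>\<bar>)"
    and f: "fbl_norm p f < \<infinity>" and g: "fbl_norm p g < \<infinity>"
  shows "fbl_norm p h < \<infinity>"
proof -
  obtain A where A: "0 \<le> A" "fbl_norm p f = ennreal A" using f by (rule fbl_norm_finiteE)
  obtain B where B: "0 \<le> B" "fbl_norm p g = ennreal B" using g by (rule fbl_norm_finiteE)
  have le: "fbl_norm p f \<le> ennreal A" "fbl_norm p g \<le> ennreal B" using A B by auto
  have "\<exists>C\<ge>0. fbl_norm p h \<le> ennreal C"
  proof (cases rule: fbl_p_cases[OF p])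
    case 1
    have "fbl_norm p h \<le> ennreal (c * (A + B))"
    proof (subst fbl_norm_le_iff[OF p])
      show "0 \<le> c * (A + B)" using c A B by auto
      have "\<bar>h \<phi>\<bar> \<le> c * (A + B)" if "\<phi> \<in> cball 0 1" for \<phi>
      proof -
        have "\<bar>f \<phi>\<bar> \<le> A" "\<bar>g \<phi>\<bar> \<le> B"
          using iffD1[OF fbl_norm_le_iff[OF p A(1)] le(1)] iffD1[OF fbl_norm_le_iff[OF p B(1)] le(2)]
            1 that by simp_all
        then have "c * (\<bar>f \<phi>\<bar> + \<bar>g \<phi>\<bar>) \<le> c * (A + B)" using c by (intro mult_left_mono) auto
        then show ?thesis using h[of \<phi>] by linarith
      qed
      then show "if p = \<infinity> then \<forall>\<phi>\<in>cball 0 1. \<bar>h \<phi>\<bar> \<le> c * (A + B)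
        else \<forall>\<phi>s\<in>fbl_admissible (enn2real p).
          (\<Sum>\<phi>\<leftarrow>\<phi>s. \<bar>h \<phi>\<bar> powr enn2real p) \<le> (c * (A + B)) powr enn2real p"
        using 1 by simp
    qed
    then show ?thesis using c A B by (metis add_nonneg_nonneg mult_nonneg_nonneg)
  next
    case 2
    define r where "r = enn2real p"
    have r: "1 \<le> r" using 2 by (simp add: r_def)
    define K where "K = (2 * c) powr r * (A powr r + B powr r)"
    have K: "0 \<le> K" by (simp add: K_def)
    have pt: "\<bar>h \<phi>\<bar> powr r \<le> (2 * c) powr r * (\<bar>f \<phi>\<bar> powr r + \<bar>g \<phi>\<bar> powr r)" for \<phi>
    proof -
      have "c * (\<bar>f \<phi>\<bar> + \<bar>g \<phi>\<bar>) \<le> c * (2 * max \<bar>f \<phi>\<bar> \<bar>g \<phi>\<bar>)"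
        using c by (intro mult_left_mono) auto
      then have "\<bar>h \<phi>\<bar> \<le> 2 * c * max \<bar>f \<phi>\<bar> \<bar>g \<phi>\<bar>" using h[of \<phi>] by (simp add: mult_ac)
      then have "\<bar>h \<phi>\<bar> powr r \<le> (2 * c * max \<bar>f \<phi>\<bar> \<bar>g \<phi>\<bar>) powr r"
        using r by (intro powr_mono2) auto
      also have "\<dots> = (2 * c) powr r * (max \<bar>f \<phi>\<bar> \<bar>g \<phi>\<bar>) powr r"
        using c by (intro powr_mult) 
      also have "\<dots> \<le> (2 * c) powr r * (\<bar>f \<phi>\<bar> powr r + \<bar>g \<phi>\<bar> powr r)"
        by (intro mult_left_mono) (auto simp: max_def)
      finally show ?thesis .
    qed
    have "fbl_norm p h \<le> ennreal (K powr (1/r))"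
    proof (subst fbl_norm_le_iff[OF p])
      have "(\<Sum>\<phi>\<leftarrow>\<phi>s. \<bar>h \<phi>\<bar> powr r) \<le> K" if "\<phi>s \<in> fbl_admissible r" for \<phi>s
      proof -
        have "(\<Sum>\<phi>\<leftarrow>\<phi>s. \<bar>h \<phi>\<bar> powr r)
            \<le> (\<Sum>\<phi>\<leftarrow>\<phi>s. (2 * c) powr r * (\<bar>f \<phi>\<bar> powr r + \<bar>g \<phi>\<bar> powr r))"
          using pt by (intro sum_list_mono) auto
        also have "\<dots> = (2 * c) powr r *
            ((\<Sum>\<phi>\<leftarrow>\<phi>s. \<bar>f \<phi>\<bar> powr r) + (\<Sum>\<phi>\<leftarrow>\<phi>s. \<bar>g \<phi>\<bar> powr r))"
          by (simp add: sum_list_const_mult sum_list_addf)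
        also have "\<dots> \<le> K" unfolding K_def
          using le 2 that fbl_norm_le_iff[OF p A(1), of f] fbl_norm_le_iff[OF p B(1), of g]
          by (intro mult_left_mono add_mono) (auto simp: r_def)
        finally show ?thesis .
      qed
      then show "if p = \<infinity> then \<forall>\<phi>\<in>cball 0 1. \<bar>h \<phi>\<bar> \<le> K powr (1/r)
        else \<forall>\<phi>s\<in>fbl_admissible (enn2real p).
          (\<Sum>\<phi>\<leftarrow>\<phi>s. \<bar>h \<phi>\<bar> powr enn2real p) \<le> (K powr (1/r)) powr enn2real p"
        using 2 r K by (auto simp: r_def[symmetric] powr_powr)
    qed auto
    then show ?thesis using powr_ge_zero by blast
  qed
  then show ?thesis by (metis ennreal_less_top infinity_ennreal_def le_less_trans)
qed

lemma fbl_abs_le_norm: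
  assumes p: "1 \<le> p" and f: "f \<in> pos_homogeneous"
  shows "ennreal \<bar>f \<phi>\<bar> \<le> ennreal (norm \<phi>) * fbl_norm p f"
proof -
  have hom: "f (c *\<^sub>R \<psi>) = c * f \<psi>" if "0 \<le> c" for c \<psi>
    using f that by (auto simp: pos_homogeneous_def)
  show ?thesis
  proof (cases "\<phi> = 0")
    case True
    then show ?thesis using hom[of 0 \<phi>] by simp
  next
    case False
    define \<psi> where "\<psi> = (1 / norm \<phi>) *\<^sub>R \<phi>"
    have n: "norm \<psi> = 1" and e: "\<phi> = norm \<phi> *\<^sub>R \<psi>" using False by (auto simp: \<psi>_def)
    have "f \<phi> = norm \<phi> * f \<psi>" by (subst e) (rule hom, simp)
    then have "ennreal \<bar>f \<phi>\<bar> = ennreal (norm \<phi>) * ennreal \<bar>f \<psi>\<bar>"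
      by (simp add: abs_mult ennreal_mult)
    moreover have "ennreal \<bar>f \<psi>\<bar> \<le> fbl_norm p f"
    proof (cases rule: fbl_p_cases[OF p])
      case 1
      then show ?thesis using n by (auto simp: fbl_norm_def intro!: SUP_upper)
    next
      case 2
      define r where "r = enn2real p"
      have r: "1 \<le> r" using 2 by (simp add: r_def)
      have "\<bar>blinfun_apply \<psi> x\<bar> powr r \<le> 1" if "norm x \<le> 1" for x
      proof -
        have "\<bar>blinfun_apply \<psi> x\<bar> \<le> 1" using norm_blinfun[of \<psi> x] n that by simp
        then have "\<bar>blinfun_apply \<psi> x\<bar> powr r \<le> 1 powr r" using r by (intro powr_mono2) auto
        then show ?thesis by simp
      qed
      then have "[\<psi>] \<in> fbl_admissible r" by (auto simp: fbl_admissible_def)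
      then have "ennreal ((\<Sum>\<phi>\<leftarrow>[\<psi>]. \<bar>f \<phi>\<bar> powr r) powr (1/r)) \<le> fbl_norm p f"
        unfolding fbl_norm_def r_def using 2 by (auto intro: SUP_upper2)
      then show ?thesis using r by (simp add: powr_powr)
    qed
    ultimately show ?thesis by (metis mult_left_mono zero_le)
  qed
qed

lemma fbl_norm_adjoint_le:
  fixes T :: "'f::real_normed_vector \<Rightarrow>\<^sub>L 'e::real_normed_vector"
  assumes p: "1 \<le> p" and f: "f \<in> pos_homogeneous"
  shows "fbl_norm p (\<lambda>\<phi>. f (\<phi> o\<^sub>L T)) \<le> ennreal (norm T + 1) * fbl_norm p f"
proof -
  define c where "c = norm T + 1"
  have c: "0 < c" "norm T \<le> c" by (auto simp: c_def add_nonneg_pos)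
  have hom: "f (a *\<^sub>R \<psi>) = a * f \<psi>" if "0 \<le> a" for a \<psi>
    using f that by (auto simp: pos_homogeneous_def)
  define S where "S = (\<lambda>\<phi> :: 'e \<Rightarrow>\<^sub>L real. (1/c) *\<^sub>R (\<phi> o\<^sub>L T))"
  have fS: "f (\<phi> o\<^sub>L T) = c * f (S \<phi>)" for \<phi>
    using hom[of c "S \<phi>"] c by (simp add: S_def)
  have Sx: "blinfun_apply (S \<phi>) x = blinfun_apply \<phi> ((1/c) *\<^sub>R blinfun_apply T x)" for \<phi> x
    by (simp add: S_def blinfun.scaleR_left blinfun.scaleR_right)
  have Tx: "norm ((1/c) *\<^sub>R blinfun_apply T x) \<le> 1" if "norm x \<le> 1" for x
  proof -
    have "norm (blinfun_apply T x) \<le> norm T * norm x" by (rule norm_blinfun)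
    also have "\<dots> \<le> c * 1" using c that by (intro mult_mono) auto
    finally show ?thesis using c by simp
  qed
  show ?thesis
  proof (cases rule: fbl_p_cases[OF p])
    case 1
    have "ennreal \<bar>f (\<phi> o\<^sub>L T)\<bar> \<le> ennreal c * fbl_norm p f" if "norm \<phi> \<le> 1" for \<phi>
    proof -
      have "norm (\<phi> o\<^sub>L T) \<le> 1 * c"
        using norm_blinfun_compose[of \<phi> T] mult_mono[OF that c(2)] c by auto
      then have "ennreal (norm (\<phi> o\<^sub>L T)) * fbl_norm p f \<le> ennreal c * fbl_norm p f"
        by (intro mult_right_mono ennreal_leI) auto
      then show ?thesis using fbl_abs_le_norm[OF p f, of "\<phi> o\<^sub>L T"] by (rule order_trans[rotated])
    qed
    then show ?thesis unfolding c_def[symmetric] fbl_norm_def[of p "\<lambda>\<phi>. f (\<phi> o\<^sub>L T)"]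
      using 1 by (auto intro!: SUP_least)
  next
    case 2
    define r where "r = enn2real p"
    have r: "1 \<le> r" using 2 by (simp add: r_def)
    have "ennreal ((\<Sum>\<phi>\<leftarrow>\<phi>s. \<bar>f (\<phi> o\<^sub>L T)\<bar> powr r) powr (1/r)) \<le> ennreal c * fbl_norm p f"
      if "\<phi>s \<in> fbl_admissible r" for \<phi>s
    proof -
      have "map S \<phi>s \<in> fbl_admissible r"
        using that Tx by (auto simp: fbl_admissible_def Sx comp_def simp del: norm_scaleR)
      then have le: "ennreal ((\<Sum>\<phi>\<leftarrow>map S \<phi>s. \<bar>f \<phi>\<bar> powr r) powr (1/r)) \<le> fbl_norm p f"
        unfolding fbl_norm_def r_def using 2 by (auto intro: SUP_upper2)
      have "(\<Sum>\<phi>\<leftarrow>\<phi>s. \<bar>f (\<phi> o\<^sub>L T)\<bar> powr r) = c powr r * (\<Sum>\<phi>\<leftarrow>map S \<phi>s. \<bar>f \<phi>\<bar> powr r)"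
        using c by (simp add: fS abs_mult powr_mult sum_list_const_mult comp_def)
      moreover have "0 \<le> (\<Sum>\<phi>\<leftarrow>map S \<phi>s. \<bar>f \<phi>\<bar> powr r)" by (rule sum_list_nonneg) auto
      ultimately have "(\<Sum>\<phi>\<leftarrow>\<phi>s. \<bar>f (\<phi> o\<^sub>L T)\<bar> powr r) powr (1/r)
          = c * (\<Sum>\<phi>\<leftarrow>map S \<phi>s. \<bar>f \<phi>\<bar> powr r) powr (1/r)"
        using c r by (simp add: powr_mult powr_powr)
      then show ?thesis using le c by (simp add: ennreal_mult mult_left_mono)
    qed
    then show ?thesis unfolding c_def[symmetric] fbl_norm_def[of p "\<lambda>\<phi>. f (\<phi> o\<^sub>L T)"]
      using 2 by (auto simp: r_def intro!: SUP_least)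
  qed
qed

lemma fbl_delta_in_H:
  assumes p: "1 \<le> p"
  shows "fbl_delta x \<in> fbl_H p"
proof -
  have "fbl_norm p (fbl_delta x) \<le> ennreal (norm x)"
  proof (subst fbl_norm_le_iff[OF p norm_ge_zero], cases rule: fbl_p_cases[OF p])
    case 1
    have "\<bar>fbl_delta x \<phi>\<bar> \<le> norm x" if "norm \<phi> \<le> 1" for \<phi>
      using norm_blinfun[of \<phi> x] mult_right_mono[OF that norm_ge_zero[of x]]
      by (simp add: fbl_delta_def)
    then show "if p = \<infinity> then \<forall>\<phi>\<in>cball 0 1. \<bar>fbl_delta x \<phi>\<bar> \<le> norm x
        else \<forall>\<phi>s\<in>fbl_admissible (enn2real p).
          (\<Sum>\<phi>\<leftarrow>\<phi>s. \<bar>fbl_delta x \<phi>\<bar> powr enn2real p) \<le> norm x powr enn2real p"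
      using 1 by simp
  next
    case 2
    define r where "r = enn2real p"
    have r: "1 \<le> r" using 2 by (simp add: r_def)
    have "(\<Sum>\<phi>\<leftarrow>\<phi>s. \<bar>fbl_delta x \<phi>\<bar> powr r) \<le> norm x powr r" if "\<phi>s \<in> fbl_admissible r" for \<phi>s
    proof -
      define y where "y = (if x = 0 then 0 else (1 / norm x) *\<^sub>R x)"
      have y: "x = norm x *\<^sub>R y" "y \<in> cball 0 1" by (auto simp: y_def)
      have "\<bar>fbl_delta x \<phi>\<bar> = norm x * \<bar>blinfun_apply \<phi> y\<bar>" for \<phi>
        using y(1) unfolding fbl_delta_def
        by (metis abs_mult abs_norm_cancel blinfun.scaleR_right real_scaleR_def)
      then have "(\<Sum>\<phi>\<leftarrow>\<phi>s. \<bar>fbl_delta x \<phi>\<bar> powr r)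
          = norm x powr r * (\<Sum>\<phi>\<leftarrow>\<phi>s. \<bar>blinfun_apply \<phi> y\<bar> powr r)"
        by (simp add: powr_mult sum_list_const_mult)
      also have "\<dots> \<le> norm x powr r * 1"
        using that y(2) by (intro mult_left_mono) (auto simp: fbl_admissible_def)
      finally show ?thesis by simp
    qed
    then show "if p = \<infinity> then \<forall>\<phi>\<in>cball 0 1. \<bar>fbl_delta x \<phi>\<bar> \<le> norm x
        else \<forall>\<phi>s\<in>fbl_admissible (enn2real p).
          (\<Sum>\<phi>\<leftarrow>\<phi>s. \<bar>fbl_delta x \<phi>\<bar> powr enn2real p) \<le> norm x powr enn2real p"
      using 2 by (simp add: r_def)
  qed
  then have "fbl_norm p (fbl_delta x) < \<infinity>"
    by (metis ennreal_less_top infinity_ennreal_def le_less_trans)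
  moreover have "fbl_delta x \<in> pos_homogeneous"
    by (simp add: pos_homogeneous_def fbl_delta_def blinfun.scaleR_left)
  ultimately show ?thesis by (simp add: fbl_H_def)
qed

lemma fbl_H_closed_sublattice:
  assumes p: "1 \<le> p"
  shows "fbl_closed_sublattice p (fbl_H p :: (('e::real_normed_vector \<Rightarrow>\<^sub>L real) \<Rightarrow> real) set)"
proof -
  have max: "a * max x y = max (a * x) (a * y)" if "0 \<le> a" for a x y :: real
    using that by (simp add: max_mult_distrib_left)
  have min: "a * min x y = min (a * x) (a * y)" if "0 \<le> a" for a x y :: real
    using that by (simp add: min_mult_distrib_left)
  have 0: "fbl_norm p (\<lambda>\<phi>::'e \<Rightarrow>\<^sub>L real. 0) < \<infinity>"
    using fbl_delta_in_H[OF p, of "0::'e"] by (simp add: fbl_H_def fbl_delta_def)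
  have 1: "fbl_norm p h < \<infinity>"
    if "fbl_norm p f < \<infinity>" "fbl_norm p g < \<infinity>" "\<And>\<phi>. \<bar>h \<phi>\<bar> \<le> \<bar>f \<phi>\<bar> + \<bar>g \<phi>\<bar>"
    for f g h :: "('e \<Rightarrow>\<^sub>L real) \<Rightarrow> real"
    using fbl_norm_dominated[OF p, of 1 h f g] that by simp
  have 2: "fbl_norm p (\<lambda>\<phi>. c * f \<phi>) < \<infinity>" if "fbl_norm p f < \<infinity>"
    for c and f :: "('e \<Rightarrow>\<^sub>L real) \<Rightarrow> real"
    using fbl_norm_dominated[OF p, of "\<bar>c\<bar>" "\<lambda>\<phi>. c * f \<phi>" f f] that
    by (simp add: abs_mult distrib_left)
  have 3: "fbl_norm p (\<lambda>\<phi>. f \<phi> + g \<phi>) < \<infinity>"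
    "fbl_norm p (\<lambda>\<phi>. max (f \<phi>) (g \<phi>)) < \<infinity>" "fbl_norm p (\<lambda>\<phi>. min (f \<phi>) (g \<phi>)) < \<infinity>"
    if "fbl_norm p f < \<infinity>" "fbl_norm p g < \<infinity>" for f g :: "('e \<Rightarrow>\<^sub>L real) \<Rightarrow> real"
    by (rule 1[OF that]; auto simp: max_def min_def)+
  show ?thesis unfolding fbl_closed_sublattice_def fbl_H_def pos_homogeneous_def
    by (auto simp: distrib_left max min 0[simplified] 2[simplified] 3[simplified])
qed

lemma FBL_closed_sublattice:
  assumes p: "1 \<le> p"
  shows "fbl_closed_sublattice p (FBL p :: (('e::real_normed_vector \<Rightarrow>\<^sub>L real) \<Rightarrow> real) set)"
proof -
  let ?F = "{L :: (('e \<Rightarrow>\<^sub>L real) \<Rightarrow> real) set. fbl_closed_sublattice p L \<and> range fbl_delta \<subseteq> L}"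
  have "fbl_H p \<in> ?F" using fbl_H_closed_sublattice[OF p] fbl_delta_in_H[OF p] by auto
  then have sub: "FBL p \<subseteq> (fbl_H p :: (('e \<Rightarrow>\<^sub>L real) \<Rightarrow> real) set)" unfolding FBL_def by (rule Inter_lower)
  have le: "f \<in> L" if "f \<in> FBL p" "L \<in> ?F" for f L using that unfolding FBL_def by (rule InterD)
  have cl: "fbl_closed_sublattice p L" if "L \<in> ?F" for L using that by simp
  have mem: "f \<in> FBL p" if "\<And>L. L \<in> ?F \<Longrightarrow> f \<in> L" for f
    unfolding FBL_def using that by (rule InterI)
  show ?thesis
    unfolding fbl_closed_sublattice_def
  proof (intro conjI ballI allI impI)
    show "FBL p \<subseteq> (fbl_H p :: (('e \<Rightarrow>\<^sub>L real) \<Rightarrow> real) set)" by (rule sub)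
    show "(\<lambda>\<phi>. 0) \<in> (FBL p :: (('e \<Rightarrow>\<^sub>L real) \<Rightarrow> real) set)"
      by (rule mem) (rule fbl_closed_sublatticeD(2)[OF cl])
    fix f :: "('e \<Rightarrow>\<^sub>L real) \<Rightarrow> real" assume f: "f \<in> FBL p"
    show "(\<lambda>\<phi>. c * f \<phi>) \<in> FBL p" for c
      by (rule mem) (rule fbl_closed_sublatticeD(4)[OF cl le[OF f]])
    fix g :: "('e \<Rightarrow>\<^sub>L real) \<Rightarrow> real" assume g: "g \<in> FBL p"
    show "(\<lambda>\<phi>. f \<phi> + g \<phi>) \<in> FBL p"
      by (rule mem) (rule fbl_closed_sublatticeD(3)[OF cl le[OF f] le[OF g]])
    show "(\<lambda>\<phi>. max (f \<phi>) (g \<phi>)) \<in> FBL p"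
      by (rule mem) (rule fbl_closed_sublatticeD(5)[OF cl le[OF f] le[OF g]])
    show "(\<lambda>\<phi>. min (f \<phi>) (g \<phi>)) \<in> FBL p"
      by (rule mem) (rule fbl_closed_sublatticeD(6)[OF cl le[OF f] le[OF g]])
  next
    fix f :: "('e \<Rightarrow>\<^sub>L real) \<Rightarrow> real"
    assume f: "f \<in> fbl_H p" "\<forall>e>0. \<exists>g\<in>FBL p. fbl_norm p (\<lambda>\<phi>. f \<phi> - g \<phi>) < ennreal e"
    show "f \<in> FBL p"
    proof (rule mem)
      fix L assume L: "L \<in> ?F"
      have "\<exists>g\<in>L. fbl_norm p (\<lambda>\<phi>. f \<phi> - g \<phi>) < ennreal e" if e: "e > 0" for e
      proof -
        obtain g where g: "g \<in> FBL p" "fbl_norm p (\<lambda>\<phi>. f \<phi> - g \<phi>) < ennreal e"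
          using f(2) e by metis
        show ?thesis by (rule bexI[of _ g]) (rule g(2), rule le[OF g(1) L])
      qed
      then show "f \<in> L" by (rule fbl_closed_sublatticeD(7)[OF cl[OF L] f(1)])
    qed
  qed
qed

lemma fbl_delta_in_FBL: "fbl_delta x \<in> FBL p"
  unfolding FBL_def by auto

lemma FBL_minimal:
  "fbl_closed_sublattice p L \<Longrightarrow> range fbl_delta \<subseteq> L \<Longrightarrow> FBL p \<subseteq> L"
  unfolding FBL_def by blast

lemma FBL_D:
  assumes "1 \<le> p" "f \<in> FBL p"
  shows "f \<in> fbl_H p" "f \<in> pos_homogeneous" "(\<lambda>\<phi>. c * f \<phi>) \<in> FBL p"
    and "g \<in> FBL p \<Longrightarrow> (\<lambda>\<phi>. f \<phi> + g \<phi>) \<in> FBL p"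
    and "g \<in> FBL p \<Longrightarrow> (\<lambda>\<phi>. f \<phi> - g \<phi>) \<in> FBL p"
    and "g \<in> FBL p \<Longrightarrow> (\<lambda>\<phi>. max (f \<phi>) (g \<phi>)) \<in> FBL p"
    and "g \<in> FBL p \<Longrightarrow> (\<lambda>\<phi>. min (f \<phi>) (g \<phi>)) \<in> FBL p"
proof -
  note cl = fbl_closed_sublatticeD[OF FBL_closed_sublattice[OF assms(1)]]
  show H: "f \<in> fbl_H p" using cl(1) assms(2) by blast
  then show "f \<in> pos_homogeneous" by (simp add: fbl_H_def)
  show "(\<lambda>\<phi>. c * f \<phi>) \<in> FBL p" by (rule cl(4)[OF assms(2)])
  show "(\<lambda>\<phi>. f \<phi> + g \<phi>) \<in> FBL p" "(\<lambda>\<phi>. max (f \<phi>) (g \<phi>)) \<in> FBL p"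
    "(\<lambda>\<phi>. min (f \<phi>) (g \<phi>)) \<in> FBL p" if "g \<in> FBL p"
    by (rule cl(3,5,6)[OF assms(2) that])+
  show "(\<lambda>\<phi>. f \<phi> - g \<phi>) \<in> FBL p" if "g \<in> FBL p"
  proof -
    have "(\<lambda>\<phi>. (-1) * g \<phi>) \<in> FBL p" by (rule cl(4)[OF that])
    then have "(\<lambda>\<phi>. f \<phi> + (-1) * g \<phi>) \<in> FBL p" by (rule cl(3)[OF assms(2)])
    then show ?thesis by simp
  qed
qed

lemma FBL_adjoint:
  fixes T :: "'f::real_normed_vector \<Rightarrow>\<^sub>L 'e::real_normed_vector"
  assumes p: "1 \<le> p" and f: "f \<in> FBL p"
  shows "(\<lambda>\<phi>. f (\<phi> o\<^sub>L T)) \<in> FBL p"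
proof -
  have H: "(\<lambda>\<phi>. f (\<phi> o\<^sub>L T)) \<in> fbl_H p" if "f \<in> fbl_H p" for f
  proof -
    have f: "f \<in> pos_homogeneous" "fbl_norm p f < \<infinity>" using that by (auto simp: fbl_H_def)
    have "(a *\<^sub>R \<phi>) o\<^sub>L T = a *\<^sub>R (\<phi> o\<^sub>L T)" for a and \<phi> :: "'e \<Rightarrow>\<^sub>L real"
      by (rule blinfun_eqI) (simp add: blinfun.scaleR_left)
    then have "(\<lambda>\<phi>. f (\<phi> o\<^sub>L T)) \<in> pos_homogeneous"
      using f(1) by (simp add: pos_homogeneous_def)
    moreover have "fbl_norm p (\<lambda>\<phi>. f (\<phi> o\<^sub>L T)) < \<infinity>"
      using fbl_norm_adjoint_le[OF p f(1), of T] f(2)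
      by (metis ennreal_less_top ennreal_mult_less_top infinity_ennreal_def le_less_trans)
    ultimately show ?thesis by (simp add: fbl_H_def)
  qed
  define L where "L = {f \<in> fbl_H p. (\<lambda>\<phi>. f (\<phi> o\<^sub>L T)) \<in> FBL p}"
  note clH = fbl_closed_sublatticeD[OF fbl_H_closed_sublattice[OF p, where 'e='f]]
  note clE = fbl_closed_sublatticeD[OF FBL_closed_sublattice[OF p, where 'e='e]]
  have "fbl_closed_sublattice p L"
    unfolding fbl_closed_sublattice_def
  proof (intro conjI ballI allI impI)
    show "L \<subseteq> fbl_H p" by (auto simp: L_def)
    show "(\<lambda>\<phi>. 0) \<in> L" using clH(2) clE(2) by (simp add: L_def)
    fix f assume f: "f \<in> L"
    show "(\<lambda>\<phi>. c * f \<phi>) \<in> L" for c using f by (simp add: L_def clH(4) clE(4))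
    fix g assume g: "g \<in> L"
    show "(\<lambda>\<phi>. f \<phi> + g \<phi>) \<in> L" using f g by (simp add: L_def clH(3) clE(3))
    show "(\<lambda>\<phi>. max (f \<phi>) (g \<phi>)) \<in> L" using f g by (simp add: L_def clH(5) clE(5))
    show "(\<lambda>\<phi>. min (f \<phi>) (g \<phi>)) \<in> L" using f g by (simp add: L_def clH(6) clE(6))
  next
    fix f assume f: "f \<in> fbl_H p" "\<forall>e>0. \<exists>g\<in>L. fbl_norm p (\<lambda>\<phi>. f \<phi> - g \<phi>) < ennreal e"
    have "\<exists>h\<in>FBL p. fbl_norm p (\<lambda>\<phi>. f (\<phi> o\<^sub>L T) - h \<phi>) < ennreal e" if e: "e > 0" for e
    proof -
      define c where "c = norm T + 1"
      have c: "0 < c" by (simp add: c_def add_nonneg_pos)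
      obtain g where g: "g \<in> L" "fbl_norm p (\<lambda>\<phi>. f \<phi> - g \<phi>) < ennreal (e / c)"
        using f(2) e c by (meson divide_pos_pos)
      have "f \<in> pos_homogeneous" "g \<in> pos_homogeneous"
        using f(1) g(1) by (auto simp: L_def fbl_H_def)
      then have "(\<lambda>\<phi>. f \<phi> - g \<phi>) \<in> pos_homogeneous"
        by (auto simp: pos_homogeneous_def algebra_simps)
      then have "fbl_norm p (\<lambda>\<phi>. f (\<phi> o\<^sub>L T) - g (\<phi> o\<^sub>L T))
          \<le> ennreal c * fbl_norm p (\<lambda>\<phi>. f \<phi> - g \<phi>)"
        unfolding c_def by (rule fbl_norm_adjoint_le[OF p])
      also have "\<dots> < ennreal c * ennreal (e / c)"
        using g(2) c by (intro ennreal_mult_strict_left_mono) auto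
      also have "\<dots> = ennreal e" using c e by (simp flip: ennreal_mult)
      finally show ?thesis using g(1) by (auto simp: L_def)
    qed
    then have "(\<lambda>\<phi>. f (\<phi> o\<^sub>L T)) \<in> FBL p" by (rule clE(7)[OF H[OF f(1)]])
    then show "f \<in> L" using f(1) by (simp add: L_def)
  qed
  moreover have "range fbl_delta \<subseteq> L"
  proof -
    have "(\<lambda>\<phi>. fbl_delta x (\<phi> o\<^sub>L T)) = fbl_delta (blinfun_apply T x)" for x
      by (simp add: fbl_delta_def)
    then show ?thesis using fbl_delta_in_H[OF p] fbl_delta_in_FBL by (auto simp: L_def)
  qed
  ultimately have "FBL p \<subseteq> L" by (rule FBL_minimal)
  then show ?thesis using f by (auto simp: L_def)
qed

lemma fbl_extension_eq:
  fixes T :: "'f::banach \<Rightarrow>\<^sub>L 'e::banach"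
  assumes p: "1 \<le> p" and S: "fbl_lattice_hom p S" "fbl_bounded p S"
    and d: "\<And>x. S (fbl_delta x) = fbl_delta (blinfun_apply T x)" and f: "f \<in> FBL p"
  shows "S f = (\<lambda>\<phi>. f (\<phi> o\<^sub>L T))"
proof -
  define L where "L = {f \<in> FBL p. S f = (\<lambda>\<phi>. f (\<phi> o\<^sub>L T))}"
  obtain C where C0: "\<And>f. f \<in> FBL p \<Longrightarrow> fbl_norm p (S f) \<le> ennreal C * fbl_norm p f"
    using S(2) by (auto simp: fbl_bounded_def)
  note hom = fbl_lattice_homD[OF S(1)]
  note clF = fbl_closed_sublatticeD[OF FBL_closed_sublattice[OF p, where 'e='f]]
  have Sdiff: "S (\<lambda>\<psi>. f \<psi> - g \<psi>) = (\<lambda>\<phi>. S f \<phi> - S g \<phi>)" if "f \<in> FBL p" "g \<in> FBL p" for f g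
  proof -
    have m: "(\<lambda>\<psi>. (-1) * g \<psi>) \<in> FBL p" by (rule clF(4)[OF that(2)])
    have "S (\<lambda>\<psi>. f \<psi> + (-1) * g \<psi>) = (\<lambda>\<phi>. S f \<phi> + S (\<lambda>\<psi>. (-1) * g \<psi>) \<phi>)"
      by (rule hom(2)[OF that(1) m])
    moreover have "S (\<lambda>\<psi>. (-1) * g \<psi>) = (\<lambda>\<phi>. (-1) * S g \<phi>)" by (rule hom(3)[OF that(2)])
    ultimately show ?thesis by simp
  qed
  have "fbl_closed_sublattice p L"
    unfolding fbl_closed_sublattice_def
  proof (intro conjI ballI allI impI)
    show "L \<subseteq> fbl_H p" using clF(1) by (auto simp: L_def)
    have "(\<lambda>\<phi>. 0) \<in> (FBL p :: (('f \<Rightarrow>\<^sub>L real) \<Rightarrow> real) set)" by (rule clF(2))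
    then have "S (\<lambda>\<psi>. 0 * (\<lambda>\<phi>. 0) \<psi>) = (\<lambda>\<phi>. 0 * S (\<lambda>\<phi>. 0) \<phi>)" by (rule hom(3))
    then show "(\<lambda>\<phi>. 0) \<in> L" using clF(2) by (simp add: L_def)
    fix f assume f: "f \<in> L"
    show "(\<lambda>\<phi>. c * f \<phi>) \<in> L" for c using f by (simp add: L_def hom(3) clF(4))
    fix g assume g: "g \<in> L"
    show "(\<lambda>\<phi>. f \<phi> + g \<phi>) \<in> L" using f g by (simp add: L_def hom(2) clF(3))
    show "(\<lambda>\<phi>. max (f \<phi>) (g \<phi>)) \<in> L" using f g by (simp add: L_def hom(4) clF(5))
    show "(\<lambda>\<phi>. min (f \<phi>) (g \<phi>)) \<in> L" using f g by (simp add: L_def hom(5) clF(6))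
  next
    fix f assume f: "f \<in> fbl_H p" "\<forall>e>0. \<exists>g\<in>L. fbl_norm p (\<lambda>\<phi>. f \<phi> - g \<phi>) < ennreal e"
    have fF: "f \<in> FBL p"
    proof -
      have "\<exists>g\<in>FBL p. fbl_norm p (\<lambda>\<phi>. f \<phi> - g \<phi>) < ennreal e" if "e > 0" for e
        using f(2) that by (auto simp: L_def)
      then show ?thesis by (rule clF(7)[OF f(1)])
    qed
    have "S f \<phi> = f (\<phi> o\<^sub>L T)" for \<phi>
    proof -
      define K where "K = norm \<phi> * \<bar>C\<bar> + norm (\<phi> o\<^sub>L T) + 1"
      have K: "0 < K" by (simp add: K_def add_nonneg_pos)
      have "\<bar>S f \<phi> - f (\<phi> o\<^sub>L T)\<bar> \<le> e" if e: "e > 0" for e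
      proof -
        obtain g where g: "g \<in> L" "fbl_norm p (\<lambda>\<phi>. f \<phi> - g \<phi>) < ennreal (e / K)"
          using f(2) e K by (meson divide_pos_pos)
        have gF: "g \<in> FBL p" and Sg: "S g \<phi> = g (\<phi> o\<^sub>L T)" using g(1) by (auto simp: L_def)
        define h where "h = (\<lambda>\<phi>. f \<phi> - g \<phi>)"
        have hF: "h \<in> FBL p" unfolding h_def by (rule FBL_D(5)[OF p fF gF])
        obtain N where N: "0 \<le> N" "fbl_norm p h = ennreal N"
          using FBL_D(1)[OF p hF] unfolding fbl_H_def by (blast elim: fbl_norm_finiteE)
        have NK: "N < e / K" using g(2) N by (simp add: h_def ennreal_less_iff)
        have SF: "S h \<in> FBL p" by (rule hom(1)[OF hF])
        have "ennreal \<bar>S h \<phi>\<bar> \<le> ennreal (norm \<phi>) * fbl_norm p (S h)"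
          by (rule fbl_abs_le_norm[OF p FBL_D(2)[OF p SF]])
        also have "\<dots> \<le> ennreal (norm \<phi>) * (ennreal \<bar>C\<bar> * ennreal N)"
        proof (rule mult_left_mono)
          have "ennreal C * ennreal N \<le> ennreal \<bar>C\<bar> * ennreal N"
            by (intro mult_right_mono ennreal_leI) auto
          then show "fbl_norm p (S h) \<le> ennreal \<bar>C\<bar> * ennreal N"
            using C0[OF hF] N by (auto intro: order_trans)
        qed simp
        also have "\<dots> = ennreal (norm \<phi> * (\<bar>C\<bar> * N))" using N by (simp add: ennreal_mult)
        finally have 1: "\<bar>S h \<phi>\<bar> \<le> norm \<phi> * (\<bar>C\<bar> * N)" using N by (simp add: ennreal_le_iff)
        have "ennreal \<bar>h (\<phi> o\<^sub>L T)\<bar> \<le> ennreal (norm (\<phi> o\<^sub>L T)) * fbl_norm p h"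
          by (rule fbl_abs_le_norm[OF p FBL_D(2)[OF p hF]])
        also have "\<dots> = ennreal (norm (\<phi> o\<^sub>L T) * N)" using N by (simp add: ennreal_mult)
        finally have 2: "\<bar>h (\<phi> o\<^sub>L T)\<bar> \<le> norm (\<phi> o\<^sub>L T) * N" using N by (simp add: ennreal_le_iff)
        have "S f \<phi> - f (\<phi> o\<^sub>L T) = S h \<phi> - h (\<phi> o\<^sub>L T)"
          using Sdiff[OF fF gF] Sg by (simp add: h_def)
        then have "\<bar>S f \<phi> - f (\<phi> o\<^sub>L T)\<bar> \<le> norm \<phi> * (\<bar>C\<bar> * N) + norm (\<phi> o\<^sub>L T) * N"
          using 1 2 by linarith
        also have "\<dots> \<le> K * N" using N by (simp add: K_def algebra_simps)
        also have "\<dots> \<le> e" using NK K by (simp add: field_simps)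
        finally show ?thesis .
      qed
      then have "\<bar>S f \<phi> - f (\<phi> o\<^sub>L T)\<bar> \<le> 0" by (rule field_le_epsilon) simp
      then show ?thesis by simp
    qed
    then show "f \<in> L" using fF by (auto simp: L_def)
  qed
  moreover have "range fbl_delta \<subseteq> L" using fbl_delta_in_FBL d by (auto simp: L_def fbl_delta_def)
  ultimately have "FBL p \<subseteq> L" by (rule FBL_minimal)
  then show ?thesis using f by (auto simp: L_def)
qed

lemma fbl_ext_unique:
  fixes T :: "'f::banach \<Rightarrow>\<^sub>L 'e::banach"
  assumes p: "1 \<le> p"
  shows "\<exists>!S. S \<in> extensional (FBL p) \<and> fbl_lattice_hom p S \<and> fbl_bounded p S \<and>
     (\<forall>x. S (fbl_delta x) = fbl_delta (blinfun_apply T x))"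
proof (rule ex_ex1I)
  let ?S = "restrict (\<lambda>f \<phi>. f (\<phi> o\<^sub>L T)) (FBL p)"
  have "fbl_lattice_hom p ?S"
    unfolding fbl_lattice_hom_def
    by (intro conjI ballI allI funcsetI) (simp_all add: FBL_adjoint[OF p] FBL_D(3,4,6,7)[OF p])
  moreover have "fbl_bounded p ?S"
    unfolding fbl_bounded_def
  proof (intro exI ballI)
    fix f :: "('f \<Rightarrow>\<^sub>L real) \<Rightarrow> real" assume f: "f \<in> FBL p"
    show "fbl_norm p (?S f) \<le> ennreal (norm T + 1) * fbl_norm p f"
      using fbl_norm_adjoint_le[OF p FBL_D(2)[OF p f], of T] f by simp
  qed
  moreover have "?S (fbl_delta x) = fbl_delta (blinfun_apply T x)" for x
    using fbl_delta_in_FBL[of x p] by (simp add: fbl_delta_def)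
  ultimately show "\<exists>S. S \<in> extensional (FBL p) \<and> fbl_lattice_hom p S \<and> fbl_bounded p S \<and>
     (\<forall>x. S (fbl_delta x) = fbl_delta (blinfun_apply T x))"
    by (intro exI[of _ ?S] conjI allI restrict_extensional)
next
  fix S S'
  assume S: "S \<in> extensional (FBL p) \<and> fbl_lattice_hom p S \<and> fbl_bounded p S \<and>
     (\<forall>x. S (fbl_delta x) = fbl_delta (blinfun_apply T x))"
    and S': "S' \<in> extensional (FBL p) \<and> fbl_lattice_hom p S' \<and> fbl_bounded p S' \<and>
     (\<forall>x. S' (fbl_delta x) = fbl_delta (blinfun_apply T x))"
  show "S = S'"
  proof (rule extensionalityI[of S "FBL p" S'])
    fix f :: "('f \<Rightarrow>\<^sub>L real) \<Rightarrow> real" assume f: "f \<in> FBL p"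
    have "S f = (\<lambda>\<phi>. f (\<phi> o\<^sub>L T))" by (rule fbl_extension_eq[OF p _ _ _ f]) (use S in simp_all)
    moreover have "S' f = (\<lambda>\<phi>. f (\<phi> o\<^sub>L T))"
      by (rule fbl_extension_eq[OF p _ _ _ f]) (use S' in simp_all)
    ultimately show "S f = S' f" by simp
  qed (use S S' in simp_all)
qed

lemma fbl_ext_apply:
  fixes T :: "'f::banach \<Rightarrow>\<^sub>L 'e::banach"
  assumes p: "1 \<le> p" and f: "f \<in> FBL p"
  shows "fbl_ext p T f = (\<lambda>\<phi>. f (\<phi> o\<^sub>L T))"
proof -
  note ext = theI'[OF fbl_ext_unique[OF p, of T], folded fbl_ext_def]
  show ?thesis by (rule fbl_extension_eq[OF p _ _ _ f]) (use ext in simp_all)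
qed

end

theory Submission
  imports Defs
begin

text \<open>The adjoint of an injective operator \<open>T\<close> has weak-star dense range, but that range need not
  be norming, so density alone does not suffice: elements of \<open>FBL p\<close> are only weak-star continuous on
  bounded sets. If such an \<open>f\<close> has \<open>f \<phi> \<noteq> 0\<close>, the Banach--Dieudonne construction gives a null
  sequence \<open>y\<close> such that \<open>f \<psi> \<noteq> 0\<close> whenever \<open>\<bar>(\<psi> - \<phi>) (y n)\<bar> \<le> 1\<close> for all \<open>n\<close>. The Hahn--Banach theorem
  in the space of bounded sequences, with the dual of \<open>c\<^sub>0\<close> being \<open>\<ell>\<^sub>1\<close>, provides such a \<open>\<psi>\<close> in any
  separating subspace, in particular in the range of the adjoint.\<close>

subsection \<open>The Hahn--Banach theorem\<close>

text \<open>For scaling only an inequality is demanded, since infima of sublinear functionals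
  satisfy it directly; equality for \<open>t > 0\<close> follows by rescaling with
  \<open>1/t\<close>.\<close>

definition sublinear :: "('a::real_vector \<Rightarrow> real) \<Rightarrow> bool" where
  "sublinear q \<longleftrightarrow> (\<forall>x y. q (x + y) \<le> q x + q y) \<and> (\<forall>t\<ge>0. \<forall>x. q (t *\<^sub>R x) \<le> t * q x)"

lemma sublinearD:
  assumes "sublinear q"
  shows "q (x + y) \<le> q x + q y"
    and "0 \<le> t \<Longrightarrow> q (t *\<^sub>R x) = t * q x"
    and "q 0 = 0"
    and "- q (- x) \<le> q x"
proof -
  have add: "q (x + y) \<le> q x + q y" for x y using assms by (simp add: sublinear_def)
  have le: "q (t *\<^sub>R x) \<le> t * q x" if "0 \<le> t" for t x using assms that by (simp add: sublinear_def)
  show 0: "q 0 = 0" using add[of 0 0] le[of 0 0] by simp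
  show "q (x + y) \<le> q x + q y" by (rule add)
  show "- q (- x) \<le> q x" using add[of x "- x"] 0 by simp
  show "q (t *\<^sub>R x) = t * q x" if "0 \<le> t"
  proof (cases "t = 0")
    case False
    then have "t * q ((1/t) *\<^sub>R (t *\<^sub>R x)) \<le> t * ((1/t) * q (t *\<^sub>R x))"
      using that by (intro mult_left_mono le) auto
    then have "t * q x \<le> q (t *\<^sub>R x)" using False by simp
    then show ?thesis using le[OF that, of x] by linarith
  qed (simp add: 0)
qed

text \<open>Since \<open>t *\<^sub>R y\<close> is the sum of \<open>x + t *\<^sub>R y\<close> and
  \<open>- x\<close>, the values along the ray never fall below \<open>- q (- x)\<close>, so the
  infimum is finite. Adding ray parameters gives subadditivity. The choice \<open>t = 0\<close>
  keeps \<open>s\<close> below \<open>q\<close>, and \<open>t = 1\<close> yields the estimate which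
  at \<open>- y\<close> reads \<open>s (- y) \<le> - q y\<close>.\<close>

lemma sublinear_INF_ray:
  fixes q :: "'a::real_vector \<Rightarrow> real" and y :: 'a
  assumes q: "sublinear q"
  defines "s \<equiv> \<lambda>x. INF t\<in>{0..}. q (x + t *\<^sub>R y) - t * q y"
  shows "sublinear s" "s x \<le> q x" "s x \<le> q (x + y) - q y"
proof -
  have low: "- q (- x) \<le> q (x + t *\<^sub>R y) - t * q y" if "0 \<le> t" for x t
    using sublinearD(1)[OF q, of "x + t *\<^sub>R y" "- x"] sublinearD(2)[OF q that, of y] by simp
  then have bdd: "bdd_below ((\<lambda>t. q (x + t *\<^sub>R y) - t * q y) ` {0..})" for x
    by (intro bdd_belowI2[where m="- q (- x)"]) auto
  have s_le: "s x \<le> q (x + t *\<^sub>R y) - t * q y" if "0 \<le> t" for x t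
    unfolding s_def using that by (intro cINF_lower[OF bdd]) auto
  have le_s: "m \<le> s x" if "\<And>t. 0 \<le> t \<Longrightarrow> m \<le> q (x + t *\<^sub>R y) - t * q y" for m x
    unfolding s_def using that by (intro cINF_greatest) auto
  show "s x \<le> q x" using s_le[of 0 x] by simp
  show "s x \<le> q (x + y) - q y" using s_le[of 1 x] by simp
  have "s (x1 + x2) \<le> s x1 + s x2" for x1 x2
  proof -
    have "s (x1 + x2) \<le> (q (x1 + t1 *\<^sub>R y) - t1 * q y) + (q (x2 + t2 *\<^sub>R y) - t2 * q y)"
      if "0 \<le> t1" "0 \<le> t2" for t1 t2
      using s_le[of "t1 + t2" "x1 + x2"] that
        sublinearD(1)[OF q, of "x1 + t1 *\<^sub>R y" "x2 + t2 *\<^sub>R y"]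
      by (simp add: algebra_simps)
    \<comment> \<open>The infima are taken one parameter at a time, first over \<open>t2\<close>,
      then over \<open>t1\<close>.\<close>
    then have "s (x1 + x2) - (q (x1 + t1 *\<^sub>R y) - t1 * q y) \<le> q (x2 + t2 *\<^sub>R y) - t2 * q y"
      if "0 \<le> t1" "0 \<le> t2" for t1 t2
      using that by (simp only: diff_le_eq add.commute)
    then have "s (x1 + x2) - (q (x1 + t1 *\<^sub>R y) - t1 * q y) \<le> s x2" if "0 \<le> t1" for t1
      using that by (intro le_s)
    then have "s (x1 + x2) - s x2 \<le> q (x1 + t1 *\<^sub>R y) - t1 * q y" if "0 \<le> t1" for t1
      using that by (simp only: diff_le_eq add.commute)
    then have "s (x1 + x2) - s x2 \<le> s x1" by (intro le_s)
    then show ?thesis by simp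
  qed
  moreover have "s (c *\<^sub>R x) \<le> c * s x" if "0 \<le> c" for c x
  proof (cases "c = 0")
    case True
    then show ?thesis using s_le[of 0 0] sublinearD(3)[OF q] by simp
  next
    case False
    then have c: "0 < c" using that by simp
    have "s (c *\<^sub>R x) / c \<le> q (x + t *\<^sub>R y) - t * q y" if "0 \<le> t" for t
    proof -
      have "s (c *\<^sub>R x) \<le> q (c *\<^sub>R (x + t *\<^sub>R y)) - (c * t) * q y"
        using s_le[of "c * t" "c *\<^sub>R x"] c that by (simp add: algebra_simps)
      then show ?thesis using c sublinearD(2)[OF q, of c "x + t *\<^sub>R y"]
        by (simp add: field_simps)
    qed
    then have "s (c *\<^sub>R x) / c \<le> s x" by (rule le_s)
    then show ?thesis using c by (simp add: field_simps)
  qed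
  ultimately show "sublinear s" by (simp add: sublinear_def)
qed

text \<open>Subadditivity rests on the chain condition: for \<open>c\<close> and \<open>d\<close> a
  common lower member \<open>e\<close> gives
  \<open>e (x + y) \<le> e x + e y \<le> c x + d y\<close>. The infimum is finite because
  \<open>- q (- x) \<le> - c (- x) \<le> c x\<close>.\<close>

lemma sublinear_INF_chain:
  assumes C: "C \<noteq> {}" "\<And>c. c \<in> C \<Longrightarrow> sublinear c" "\<And>c. c \<in> C \<Longrightarrow> c \<le> q"
    and chain: "\<And>c d. c \<in> C \<Longrightarrow> d \<in> C \<Longrightarrow> c \<le> d \<or> d \<le> c"
  shows "sublinear (\<lambda>x. INF c\<in>C. c x)" "c \<in> C \<Longrightarrow> (\<lambda>x. INF c\<in>C. c x) \<le> c"
proof -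
  let ?u = "\<lambda>x. INF c\<in>C. c x"
  have "- q (- x) \<le> c x" if "c \<in> C" for c x
    using sublinearD(4)[OF C(2)[OF that], of x] le_funD[OF C(3)[OF that], of "- x"] by linarith
  then have bdd: "bdd_below ((\<lambda>c. c x) ` C)" for x by (rule bdd_belowI2)
  have u_le: "?u x \<le> c x" if "c \<in> C" for c x by (rule cINF_lower[OF bdd that])
  then show "c \<in> C \<Longrightarrow> ?u \<le> c" by (auto intro: le_funI)
  have le_u: "m \<le> ?u x" if "\<And>c. c \<in> C \<Longrightarrow> m \<le> c x" for m x
    using that by (intro cINF_greatest[OF C(1)])
  have "?u (x + y) \<le> ?u x + ?u y" for x y
  proof -
    have *: "?u (x + y) \<le> c x + d y" if c: "c \<in> C" and d: "d \<in> C" for c d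
    proof -
      obtain e where "e \<in> C" "e \<le> c" "e \<le> d" using chain[OF c d] c d by blast
      then show ?thesis
        using u_le[of e "x + y"] sublinearD(1)[OF C(2), of e x y] le_funD[of e c x] le_funD[of e d y]
        by linarith
    qed
    have "?u (x + y) - c x \<le> ?u y" if "c \<in> C" for c
      using *[OF that] by (intro le_u) (simp add: algebra_simps)
    then have "?u (x + y) - ?u y \<le> c x" if "c \<in> C" for c using that by (fastforce simp: algebra_simps)
    then have "?u (x + y) - ?u y \<le> ?u x" by (rule le_u)
    then show ?thesis by simp
  qed
  moreover have "?u (t *\<^sub>R x) \<le> t * ?u x" if "0 \<le> t" for t x
  proof (cases "t = 0")
    case True
    obtain c where "c \<in> C" using C(1) by blast
    then show ?thesis using u_le[of c 0] sublinearD(3)[OF C(2), of c] True by simp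
  next
    case False
    then have "?u (t *\<^sub>R x) / t \<le> c x" if "c \<in> C" for c
      using u_le[OF that, of "t *\<^sub>R x"] sublinearD(2)[OF C(2)[OF that] \<open>0 \<le> t\<close>, of x] \<open>0 \<le> t\<close>
      by (simp add: field_simps)
    then have "?u (t *\<^sub>R x) / t \<le> ?u x" by (rule le_u)
    then show ?thesis using False that by (simp add: field_simps)
  qed
  ultimately show "sublinear ?u" by (simp add: sublinear_def)
qed

text \<open>A minimal sublinear functional is linear: replacing \<open>m\<close> by its infimum along a ray in
  direction \<open>y\<close> does not decrease it, which gives \<open>m x + m y \<le> m (x + y)\<close>.\<close>

lemma sublinear_minimal_linear:
  assumes "sublinear q"
  obtains m where "linear m" "m \<le> q"
proof -
  define A where "A = {s. sublinear s \<and> s \<le> q}"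
  have qA: "q \<in> A" using assms by (simp add: A_def)
  \<comment> \<open>Zorn's lemma is applied to the reversed order, so chains need lower bounds and
    the element obtained is minimal. The empty chain is bounded by \<open>q\<close>.\<close>
  have "\<exists>m\<in>A. \<forall>a\<in>A. a \<le> m \<longrightarrow> a = m"
  proof (rule predicate_Zorn[where P="\<lambda>a b. b \<le> a"])
    show "partial_order_on A (relation_of (\<lambda>a b. b \<le> a) A)"
      by (auto simp: partial_order_on_def preorder_on_def relation_of_def refl_on_def trans_def antisym_def)
    fix C assume "C \<in> Chains (relation_of (\<lambda>a b. b \<le> a) A)"
    then have C: "\<And>c. c \<in> C \<Longrightarrow> c \<in> A" "\<And>c d. c \<in> C \<Longrightarrow> d \<in> C \<Longrightarrow> c \<le> d \<or> d \<le> c"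
      by (auto simp: Chains_def relation_of_def)
    show "\<exists>u\<in>A. \<forall>a\<in>C. u \<le> a"
    proof (cases "C = {}")
      case False
      have "\<And>c. c \<in> C \<Longrightarrow> sublinear c" "\<And>c. c \<in> C \<Longrightarrow> c \<le> q" using C(1) by (auto simp: A_def)
      note u = sublinear_INF_chain[OF False this C(2)]
      obtain c where "c \<in> C" using False by blast
      then have "(\<lambda>x. INF c\<in>C. c x) \<le> q" using u(2) C(1) unfolding A_def by (blast intro: order_trans)
      then show ?thesis using u by (auto simp: A_def)
    qed (use qA in blast)
  qed
  then obtain m where m: "sublinear m" "m \<le> q" and min: "\<And>a. sublinear a \<Longrightarrow> a \<le> m \<Longrightarrow> a = m"
    unfolding A_def by (blast intro: order_trans)
  have add: "m (x + y) = m x + m y" for x y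
  proof -
    have eq: "(\<lambda>x. INF t\<in>{0..}. m (x + t *\<^sub>R y) - t * m y) = m"
      by (intro min sublinear_INF_ray(1)[OF m(1)] le_funI sublinear_INF_ray(2)[OF m(1)])
    have "m x \<le> m (x + y) - m y"
      using sublinear_INF_ray(3)[OF m(1), of x y] fun_cong[OF eq, of x] by linarith
    then show ?thesis using sublinearD(1)[OF m(1), of x y] by linarith
  qed
  then have neg: "m (- x) = - m x" for x
    using add[of x "- x"] sublinearD(3)[OF m(1)] by simp
  have "m (t *\<^sub>R x) = t * m x" for t x
  proof (cases "0 \<le> t")
    case False
    then show ?thesis using sublinearD(2)[OF m(1), of "- t" x] neg[of "t *\<^sub>R x"] by simp
  qed (rule sublinearD(2)[OF m(1)])
  then have "linear m" using add by (intro linearI) auto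
  then show thesis using m(2) that by blast
qed

text \<open>Domination by the ray infimum in direction \<open>y\<close>, and not merely by
  \<open>q\<close>, forces \<open>L (- y) \<le> - q y\<close>, hence equality at
  \<open>y\<close>.\<close>

theorem Hahn_Banach_sublinear:
  assumes q: "sublinear q"
  obtains L where "linear L" "\<And>x. L x \<le> q x" "L y = q y"
proof -
  let ?s = "\<lambda>x. INF t\<in>{0..}. q (x + t *\<^sub>R y) - t * q y"
  obtain L where L: "linear L" "L \<le> ?s"
    using sublinear_minimal_linear sublinear_INF_ray(1)[OF q] by blast
  have le: "L x \<le> q x" for x using le_funD[OF L(2), of x] sublinear_INF_ray(2)[OF q] by (rule order_trans)
  have "L (- y) \<le> - q y"
    using order_trans[OF le_funD[OF L(2), of "- y"] sublinear_INF_ray(3)[OF q, of "- y" y]]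
      sublinearD(3)[OF q] by simp
  then have "L y = q y" using le[of y] linear_neg[OF L(1), of y] by simp
  then show thesis using that L(1) le by blast
qed

text \<open>The distance to \<open>M\<close> is sublinear, so some linear \<open>L\<close> below it
  agrees with it at \<open>x\<close>. Applied to \<open>m\<close> and \<open>- m\<close>, the bound
  makes \<open>L\<close> vanish on \<open>M\<close>. The distance is at most the norm, so
  \<open>L\<close> is bounded; it is positive at \<open>x\<close> because \<open>x\<close> lies
  outside the closure.\<close>

corollary Hahn_Banach_subspace:
  fixes M :: "'a::real_normed_vector set"
  assumes M: "subspace M" and x: "x \<notin> closure M"
  obtains l :: "'a \<Rightarrow>\<^sub>L real" where "\<And>m. m \<in> M \<Longrightarrow> l m = 0" "l x \<noteq> 0"
proof -
  have 0: "0 \<in> M" and ne: "M \<noteq> {}" using subspace_0[OF M] by auto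
  have "sublinear (\<lambda>x. infdist x M)"
    unfolding sublinear_def
  proof (intro conjI allI impI)
    fix x y
    show "infdist (x + y) M \<le> infdist x M + infdist y M"
    proof -
      have "infdist (x + y) M \<le> dist x a + dist y b" if "a \<in> M" "b \<in> M" for a b
        using infdist_le[OF subspace_add[OF M that], of "x + y"] dist_triangle_add[of x y a b]
        by linarith
      then have "infdist (x + y) M - dist x a \<le> infdist y M" if "a \<in> M" for a
        unfolding infdist_notempty[OF ne] using that
        by (intro cINF_greatest[OF ne]) (simp add: infdist_notempty[OF ne] algebra_simps)
      then have "infdist (x + y) M - infdist y M \<le> infdist x M"
        unfolding infdist_notempty[OF ne, of x]
        by (intro cINF_greatest[OF ne]) (fastforce simp: algebra_simps)
      then show ?thesis by simp
    qed
    fix t :: real assume t: "0 \<le> t"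
    show "infdist (t *\<^sub>R x) M \<le> t * infdist x M"
    proof (cases "t = 0")
      case False
      have "infdist (t *\<^sub>R x) M / t \<le> dist x a" if "a \<in> M" for a
      proof -
        have "infdist (t *\<^sub>R x) M \<le> dist (t *\<^sub>R x) (t *\<^sub>R a)"
          by (intro infdist_le subspace_scale[OF M] that)
        also have "\<dots> = t * dist x a" using t by (simp add: dist_norm flip: scaleR_diff_right)
        finally show ?thesis using t False by (simp add: field_simps)
      qed
      then have "infdist (t *\<^sub>R x) M / t \<le> infdist x M"
        unfolding infdist_notempty[OF ne, of x] by (intro cINF_greatest[OF ne])
      then show ?thesis using t False by (simp add: field_simps)
    qed (use 0 in simp)
  qed
  then obtain L where L: "linear L" "\<And>z. L z \<le> infdist z M" "L x = infdist x M"
    using Hahn_Banach_sublinear by blast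
  have le: "L z \<le> norm z" for z using L(2)[of z] infdist_le[OF 0, of z] by simp
  have "bounded_linear L"
  proof (rule bounded_linear_intro[where K=1])
    show "norm (L z) \<le> norm z * 1" for z
      using le[of z] le[of "- z"] linear_neg[OF L(1), of z] by simp
  qed (simp_all add: linear_add[OF L(1)] linear_scale[OF L(1)])
  then have ap: "blinfun_apply (Blinfun L) = L" by (rule bounded_linear_Blinfun_apply)
  show thesis
  proof (rule that[of "Blinfun L"])
    show "Blinfun L m = 0" if "m \<in> M" for m
      using L(2)[of m] L(2)[of "- m"] linear_neg[OF L(1), of m] that subspace_neg[OF M that]
      by (simp add: ap)
    show "Blinfun L x \<noteq> 0" using x by (simp add: ap L(3) in_closure_iff_infdist_zero[OF ne])
  qed
qed

corollary dual_separates_points: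
  fixes x :: "'a::real_normed_vector"
  assumes "\<And>l :: 'a \<Rightarrow>\<^sub>L real. l x = 0"
  shows "x = 0"
proof (rule ccontr)
  assume "x \<noteq> 0"
  then have "x \<notin> closure {0}" by simp
  then obtain l :: "'a \<Rightarrow>\<^sub>L real" where "l x \<noteq> 0"
    by (metis Hahn_Banach_subspace[OF subspace_single_0])
  then show False using assms by blast
qed

subsection \<open>The weak-star topology on bounded sets\<close>

text \<open>Functionals are plain functions here, because the pointwise topology of the function type is
  the weak-star topology, whereas \<open>blinfun\<close> carries the norm topology.\<close>

definition dual_ball :: "real \<Rightarrow> ('a::real_normed_vector \<Rightarrow> real) set" where
  "dual_ball R = {u. linear u \<and> (\<forall>x. \<bar>u x\<bar> \<le> R * norm x)}"

lemma dual_ball_mono: "R \<le> R' \<Longrightarrow> dual_ball R \<subseteq> dual_ball R'"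
  unfolding dual_ball_def by (auto intro: order_trans[OF _ mult_right_mono])

lemma blinfun_in_dual_ball: "blinfun_apply \<phi> \<in> dual_ball (norm \<phi>)"
  using norm_blinfun[of \<phi>]
  by (auto simp: dual_ball_def bounded_linear.linear blinfun.bounded_linear_right)

text \<open>\<open>Blinfun\<close> is meaningful only at bounded linear functions; this lets plain
  functions in a ball pass back to the dual space.\<close>

lemma dual_ball_Blinfun:
  assumes "u \<in> dual_ball R" "0 \<le> R"
  shows "blinfun_apply (Blinfun u) = u" "norm (Blinfun u) \<le> R"
proof -
  have "bounded_linear u"
    using assms(1) by (intro bounded_linear_intro[where K=R])
      (auto simp: dual_ball_def linear_add linear_scale mult.commute)
  then show eq: "blinfun_apply (Blinfun u) = u" by (rule bounded_linear_Blinfun_apply)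
  show "norm (Blinfun u) \<le> R"
    using assms by (intro norm_blinfun_bound) (auto simp: eq dual_ball_def)
qed

lemma closed_dual_ball: "closed (dual_ball R)"
proof -
  have "dual_ball R = (\<Inter>x. \<Inter>y. {u. u (x + y) = u x + u y}) \<inter>
      (\<Inter>c. \<Inter>x. {u. u (c *\<^sub>R x) = c * u x}) \<inter> (\<Inter>x. {u. \<bar>u x\<bar> \<le> R * norm x})"
    by (auto simp: dual_ball_def linear_iff)
  also have "closed \<dots>"
    by (intro closed_Int closed_INT ballI closed_Collect_eq closed_Collect_le continuous_intros
        continuous_on_product_coordinates)
  finally show ?thesis .
qed

text \<open>By Tychonoff the product of the intervals of radius \<open>R * norm x\<close> is
  compact, and the dual ball is a closed subset of it.\<close>

theorem Banach_Alaoglu: "compact (dual_ball R)"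
proof -
  let ?P = "PiE UNIV (\<lambda>x::'a. cball (0::real) (R * norm x))"
  have "compact ?P"
    using compactin_PiE[of "\<lambda>_. euclidean" UNIV "\<lambda>x::'a. cball (0::real) (R * norm x)"]
    by (simp add: euclidean_product_topology)
  then have "compact (?P \<inter> dual_ball R)" using closed_dual_ball by (rule compact_Int_closed)
  moreover have "?P \<inter> dual_ball R = dual_ball R" by (auto simp: dual_ball_def)
  ultimately show ?thesis by simp
qed

text \<open>A functional bounded by \<open>1\<close> at every \<open>x\<close> with \<open>k * norm x \<le> 1\<close> already lies in \<open>dual_ball k\<close>;
  compactness then makes finitely many such \<open>x\<close> suffice.\<close>

lemma finite_polar_step:
  fixes V :: "('a::real_normed_vector \<Rightarrow> real) set"
  assumes V: "\<And>R. compact (V \<inter> dual_ball R)"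
    and A: "V \<inter> dual_ball (real k) \<inter> {u. \<forall>x\<in>A. \<bar>u x\<bar> \<le> 1} = {}"
  obtains B where "finite B" "\<forall>x\<in>B. real k * norm x \<le> 1"
    "V \<inter> dual_ball (real (Suc k)) \<inter> {u. \<forall>x\<in>A \<union> B. \<bar>u x\<bar> \<le> 1} = {}"
proof -
  let ?S = "{x::'a. real k * norm x \<le> 1}"
  have cl: "closed {u::'a \<Rightarrow> real. \<bar>u x\<bar> \<le> 1}" for x
    by (intro closed_Collect_le continuous_intros continuous_on_product_coordinates)
  have "{u::'a \<Rightarrow> real. \<forall>x\<in>A. \<bar>u x\<bar> \<le> 1} = (\<Inter>x\<in>A. {u. \<bar>u x\<bar> \<le> 1})" by auto
  then have "closed {u::'a \<Rightarrow> real. \<forall>x\<in>A. \<bar>u x\<bar> \<le> 1}" using cl by auto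
  then have comp: "compact (V \<inter> dual_ball (real (Suc k)) \<inter> {u. \<forall>x\<in>A. \<bar>u x\<bar> \<le> 1})" (is "compact ?K")
    by (intro compact_Int_closed V)
  have "\<exists>B. finite B \<and> B \<subseteq> ?S \<and> ?K \<inter> (\<Inter>x\<in>B. {u. \<bar>u x\<bar> \<le> 1}) = {}"
  proof (rule ccontr)
    assume "\<not> ?thesis"
    then have "?K \<inter> (\<Inter>x\<in>B. {u. \<bar>u x\<bar> \<le> 1}) \<noteq> {}" if "finite B" "B \<subseteq> ?S" for B
      using that by simp
    then have "?K \<inter> (\<Inter>x\<in>?S. {u. \<bar>u x\<bar> \<le> 1}) \<noteq> {}"
      by (rule compact_imp_fip_image[OF comp cl])
    then obtain u where "u \<in> ?K \<inter> (\<Inter>x\<in>?S. {u. \<bar>u x\<bar> \<le> 1})"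
      unfolding ex_in_conv[symmetric] by (elim exE)
    then have u: "u \<in> ?K" and u1: "\<And>x. real k * norm x \<le> 1 \<Longrightarrow> \<bar>u x\<bar> \<le> 1" by simp_all
    have lin: "linear u" using u by (simp add: dual_ball_def)
    have "\<bar>u x\<bar> \<le> real k * norm x" for x
    \<comment> \<open>The vector is scaled by \<open>1/t\<close> for \<open>t\<close> above
      \<open>real k * norm x\<close>, because \<open>real k * norm x\<close> itself may be
      zero.\<close>
    proof (rule dense_ge)
      fix t assume t: "real k * norm x < t"
      have "0 \<le> real k * norm x" by simp
      then have t0: "0 < t" using t by linarith
      then have "real k * norm ((1/t) *\<^sub>R x) \<le> 1" using t by (simp add: field_simps)
      then have "\<bar>u ((1/t) *\<^sub>R x)\<bar> \<le> 1" by (rule u1)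
      then show "\<bar>u x\<bar> \<le> t" using t0 by (simp add: linear_scale[OF lin] abs_mult field_simps)
    qed
    then have "u \<in> V \<inter> dual_ball (real k) \<inter> {u. \<forall>x\<in>A. \<bar>u x\<bar> \<le> 1}"
      using u lin by (auto simp: dual_ball_def)
    then show False using A by blast
  qed
  then obtain B where B: "finite B" "B \<subseteq> ?S" "?K \<inter> (\<Inter>x\<in>B. {u. \<bar>u x\<bar> \<le> 1}) = {}" by blast
  then show thesis by (intro that[of B]) auto
qed

text \<open>Finite sets \<open>F n\<close> are enlarged step by step so that their polars miss
  \<open>V\<close> within radius \<open>n\<close>, the points added after stage \<open>n\<close>
  having norm at most \<open>1/n\<close>. An enumeration of their union is then a null sequence
  whose polar misses \<open>V\<close> in every ball.\<close>

theorem Banach_Dieudonne: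
  fixes V :: "('a::real_normed_vector \<Rightarrow> real) set"
  assumes V: "\<And>R. compact (V \<inter> dual_ball R)" and 0: "(\<lambda>x. 0) \<notin> V"
  obtains y :: "nat \<Rightarrow> 'a" where "y \<longlonglongrightarrow> 0"
    "\<And>u R. u \<in> V \<Longrightarrow> u \<in> dual_ball R \<Longrightarrow> \<exists>n. \<bar>u (y n)\<bar> > 1"
proof -
  let ?P = "\<lambda>n A. finite A \<and> V \<inter> dual_ball (real n) \<inter> {u. \<forall>x\<in>A. \<bar>u x\<bar> \<le> 1} = {}"
  let ?Q = "\<lambda>n A A'. A \<subseteq> A' \<and> (\<forall>x\<in>A' - A. real n * norm x \<le> 1)"
  have "\<exists>F :: nat \<Rightarrow> 'a set. \<forall>n. ?P n (F n) \<and> ?Q n (F n) (F (Suc n))"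
  proof (rule dependent_nat_choice)
    \<comment> \<open>The ball of radius \<open>0\<close> contains only the zero functional, so the
      empty set starts the construction. The points added at stage \<open>0\<close> are unrestricted
      in norm, but finite in number.\<close>
    have "u = (\<lambda>x. 0)" if "u \<in> dual_ball 0" for u :: "'a \<Rightarrow> real"
      using that by (auto simp: dual_ball_def)
    then show "\<exists>A. ?P 0 A" using 0 by (intro exI[of _ "{}"]) auto
    fix A n assume A: "?P n A"
    then obtain B where "finite B" "\<forall>x\<in>B. real n * norm x \<le> 1"
      "V \<inter> dual_ball (real (Suc n)) \<inter> {u. \<forall>x\<in>A \<union> B. \<bar>u x\<bar> \<le> 1} = {}"
      using finite_polar_step[OF V, of n A] by blast
    then show "\<exists>A'. ?P (Suc n) A' \<and> ?Q n A A'" using A by (intro exI[of _ "A \<union> B"]) auto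
  qed
  then obtain F :: "nat \<Rightarrow> 'a set" where F: "\<And>n. ?P n (F n)" "\<And>n. ?Q n (F n) (F (Suc n))" by blast
  define D where "D = (\<Union>n. F n)"
  \<comment> \<open>A point of \<open>D\<close> outside \<open>F n\<close> enters at some stage
    \<open>m \<ge> n\<close>, so its norm is at most \<open>1/m\<close> and hence at most
    \<open>1/n\<close> when \<open>n > 0\<close>.\<close>
  have small: "real n * norm x \<le> 1" if x: "x \<in> D" "x \<notin> F n" for n x
  proof -
    obtain m where m: "x \<in> F m" using x(1) by (auto simp: D_def)
    have "x \<notin> F m \<or> real n * norm x \<le> 1" if "n \<le> m" for m
      using that
    proof (induction m rule: dec_induct)
      case (step m)
      have "real n * norm x \<le> real m * norm x" using step(1) by (intro mult_right_mono) auto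
      moreover have "x \<in> F (Suc m) \<Longrightarrow> x \<notin> F m \<Longrightarrow> real m * norm x \<le> 1" using F(2)[of m] by blast
      ultimately show ?case using step(3) by linarith
    qed (use x(2) in blast)
    moreover have "n \<le> m"
    proof (rule ccontr)
      assume "\<not> n \<le> m"
      then have "F m \<subseteq> F n" using lift_Suc_mono_le[of F m n] F(2) by simp
      then show False using m x(2) by blast
    qed
    ultimately show ?thesis using m by blast
  qed
  have "countable D" unfolding D_def using F(1) by (intro countable_UN) (auto intro: countable_finite)
  \<comment> \<open>\<open>D\<close> may be finite or empty; indices that enumerate nothing get the
    harmless value \<open>0\<close>.\<close>
  define y where "y n = (if n \<in> to_nat_on D ` D then inv_into D (to_nat_on D) n else 0)" for n
  have inj: "inj_on (to_nat_on D) D" using \<open>countable D\<close> by (rule inj_on_to_nat_on)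
  have y: "y (to_nat_on D x) = x" if "x \<in> D" for x
    using that inj by (simp add: y_def inv_into_f_f)
  show thesis
  proof (rule that[of y])
    show "y \<longlonglongrightarrow> 0"
      unfolding tendsto_iff eventually_cofinite cofinite_eq_sequentially[symmetric]
    proof (intro allI impI)
      fix e :: real assume e: "0 < e"
      obtain k where k: "1 / e < real k" using reals_Archimedean2 by blast
      \<comment> \<open>Points of norm at least \<open>e > 1/k\<close> cannot have been added after
        \<open>F k\<close>, which is finite.\<close>
      have "{n. \<not> dist (y n) 0 < e} \<subseteq> to_nat_on D ` F k"
      proof
        fix n assume "n \<in> {n. \<not> dist (y n) 0 < e}"
        then have n: "e \<le> norm (y n)" by simp
        then have "n \<in> to_nat_on D ` D" using e by (auto simp: y_def split: if_splits)
        then obtain x where x: "x \<in> D" "n = to_nat_on D x" by blast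
        have "1 < real k * e" using k e by (simp add: field_simps)
        also have "\<dots> \<le> real k * norm x" using n x y by (intro mult_left_mono) auto
        finally have "x \<in> F k" using small[OF x(1), of k] by linarith
        then show "n \<in> to_nat_on D ` F k" using x by blast
      qed
      then show "finite {n. \<not> dist (y n) 0 < e}" using F(1) by (blast intro: finite_subset)
    qed
    fix u R assume u: "u \<in> V" "u \<in> dual_ball R"
    obtain k where "R \<le> real k" using real_arch_simple by blast
    then have "u \<in> dual_ball (real k)" using u(2) dual_ball_mono by blast
    then obtain x where "x \<in> F k" "\<bar>u x\<bar> > 1" using F(1)[of k] u(1) by fastforce
    moreover from this have "x \<in> D" by (auto simp: D_def)
    ultimately show "\<exists>n. \<bar>u (y n)\<bar> > 1" using y by metis
  qed
qed

section \<open>Null sequences and the duality of c_0 and l_1\<close>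

text \<open>Bounded continuous functions on the discrete space \<open>nat\<close> are the bounded
  sequences. The coefficients are the values of \<open>l\<close> at the unit sequences; they
  determine \<open>l\<close> on null sequences because those are sup-norm limits of their
  truncations.\<close>

lemma bcontfun_null_representation:
  fixes l :: "(nat \<Rightarrow>\<^sub>C real) \<Rightarrow>\<^sub>L real"
  obtains a :: "nat \<Rightarrow> real" where "summable (\<lambda>n. \<bar>a n\<bar>)"
    "\<And>v :: nat \<Rightarrow>\<^sub>C real. apply_bcontfun v \<longlonglongrightarrow> 0 \<Longrightarrow> (\<lambda>n. a n * v n) sums l v"
proof -
  have bc: "apply_bcontfun (Bcontfun g) = g" if "\<And>n. \<bar>g n\<bar> \<le> b" for g :: "nat \<Rightarrow> real" and b
    using that by (intro Bcontfun_inverse bcontfun_normI) auto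
  define e where "e i = Bcontfun (\<lambda>n. if n = i then 1 else 0 :: real)" for i :: nat
  have e: "apply_bcontfun (e i) n = (if n = i then 1 else 0)" for i n
    unfolding e_def by (subst bc[where b=1]) auto
  have ap_sum: "apply_bcontfun (\<Sum>i\<in>I. c i *\<^sub>R e i) n = (if n \<in> I then c n else 0)" if "finite I" for I c n
    using that by (induction I) (auto simp: e)
  have l_sum: "l (\<Sum>i\<in>I. c i *\<^sub>R e i) = (\<Sum>i\<in>I. c i * l (e i))" for I c
    by (simp add: blinfun.sum_right blinfun.scaleR_right)
  show thesis
  proof (rule that[of "\<lambda>i. l (e i)"])
    have "(\<Sum>i<n. \<bar>l (e i)\<bar>) \<le> norm l" for n
    proof -
      \<comment> \<open>The sign sequence has sup norm at most \<open>1\<close> and turns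
        \<open>l\<close> into the sum of absolute values.\<close>
      let ?v = "\<Sum>i<n. sgn (l (e i)) *\<^sub>R e i"
      have "(\<Sum>i<n. \<bar>l (e i)\<bar>) = l ?v" by (simp add: l_sum abs_sgn mult.commute)
      also have "\<dots> \<le> norm l * norm ?v" using norm_blinfun[of l ?v] by simp
      also have "\<dots> \<le> norm l * 1"
        by (intro mult_left_mono norm_bound) (auto simp: ap_sum abs_sgn_eq)
      finally show ?thesis by simp
    qed
    then show "summable (\<lambda>i. \<bar>l (e i)\<bar>)" by (intro bounded_imp_summable[where B="norm l"]) (simp_all only: lessThan_Suc_atMost[symmetric] abs_ge_zero)
    fix v :: "nat \<Rightarrow>\<^sub>C real" assume v: "apply_bcontfun v \<longlonglongrightarrow> 0"
    have "(\<lambda>n. \<Sum>i<n. v i *\<^sub>R e i) \<longlonglongrightarrow> v"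
    proof (rule LIMSEQ_I)
      fix r :: real assume r: "0 < r"
      obtain N where N: "\<And>n. N \<le> n \<Longrightarrow> \<bar>v n\<bar> < r / 2"
        using LIMSEQ_D[OF v, of "r/2"] r by auto
      have "norm ((\<Sum>i<n. v i *\<^sub>R e i) - v) \<le> r / 2" if "N \<le> n" for n
        using N that r by (intro norm_bound) (auto simp: ap_sum not_less intro!: less_imp_le)
      then show "\<exists>N. \<forall>n\<ge>N. norm ((\<Sum>i<n. v i *\<^sub>R e i) - v) < r"
        using r by (intro exI[of _ N]) fastforce
    qed
    then have "(\<lambda>n. l (\<Sum>i<n. v i *\<^sub>R e i)) \<longlonglongrightarrow> l v" by (intro tendsto_intros)
    then show "(\<lambda>i. l (e i) * v i) sums l v" by (simp add: sums_def l_sum mult.commute)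
  qed
qed

lemma separating_subspace_dense_on_null_sequence:
  fixes W :: "('a::banach \<Rightarrow>\<^sub>L real) set" and y :: "nat \<Rightarrow> 'a" and \<phi> :: "'a \<Rightarrow>\<^sub>L real"
  assumes W: "subspace W" and sep: "\<And>x. (\<And>w. w \<in> W \<Longrightarrow> w x = 0) \<Longrightarrow> x = 0"
    and y: "y \<longlonglongrightarrow> 0" and e: "0 < e"
  shows "\<exists>w\<in>W. \<forall>n. \<bar>(w - \<phi>) (y n)\<bar> < e"
proof -
  obtain K where K: "\<And>n. norm (y n) \<le> K" using convergent_imp_Bseq[OF convergentI[OF y]] BseqE by blast
  define s :: "('a \<Rightarrow>\<^sub>L real) \<Rightarrow> nat \<Rightarrow>\<^sub>C real" where "s \<psi> = Bcontfun (\<lambda>n. \<psi> (y n))" for \<psi>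
  have s: "apply_bcontfun (s \<psi>) = (\<lambda>n. \<psi> (y n))" for \<psi>
    unfolding s_def
  proof (intro Bcontfun_inverse bcontfun_normI)
    show "norm (\<psi> (y n)) \<le> norm \<psi> * K" for n
      using norm_blinfun[of \<psi> "y n"] mult_left_mono[OF K[of n], of "norm \<psi>"] by simp
  qed auto
  have lin: "linear s"
    by (rule linearI; rule bcontfun_eqI; simp add: s blinfun.add_left blinfun.scaleR_left)
  have "s \<phi> \<in> closure (s ` W)"
  proof (rule ccontr)
    assume "s \<phi> \<notin> closure (s ` W)"
    then obtain l :: "(nat \<Rightarrow>\<^sub>C real) \<Rightarrow>\<^sub>L real" where l: "\<And>w. w \<in> W \<Longrightarrow> l (s w) = 0" "l (s \<phi>) \<noteq> 0"
      by (rule Hahn_Banach_subspace[OF linear_subspace_image[OF lin W]]) blast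
    obtain a where a: "summable (\<lambda>n. \<bar>a n\<bar>)"
      "\<And>v :: nat \<Rightarrow>\<^sub>C real. apply_bcontfun v \<longlonglongrightarrow> 0 \<Longrightarrow> (\<lambda>n. a n * v n) sums l v"
      using bcontfun_null_representation[of l] by blast
    define z where "z = (\<Sum>n. a n *\<^sub>R y n)"
    have "summable (\<lambda>n. a n *\<^sub>R y n)"
    proof (rule summable_comparison_test')
      show "summable (\<lambda>n. K * \<bar>a n\<bar>)" using a(1) by (rule summable_mult)
      show "norm (a n *\<^sub>R y n) \<le> K * \<bar>a n\<bar>" for n using mult_left_mono[OF K[of n], of "\<bar>a n\<bar>"] by (simp add: mult.commute)
    qed
    then have z: "(\<lambda>n. a n *\<^sub>R y n) sums z" unfolding z_def by (rule summable_sums)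
    have lz: "l (s \<psi>) = \<psi> z" for \<psi>
    proof (rule sums_unique2)
      have "(\<lambda>n. \<psi> (y n)) \<longlonglongrightarrow> \<psi> 0" using y by (intro tendsto_intros)
      then show "(\<lambda>n. a n * s \<psi> n) sums l (s \<psi>)" by (intro a(2)) (simp add: s blinfun.zero_right)
      show "(\<lambda>n. a n * s \<psi> n) sums \<psi> z"
        using bounded_linear.sums[OF blinfun.bounded_linear_right z, of \<psi>]
        by (simp add: s blinfun.scaleR_right)
    qed
    then have "z = 0" using l(1) by (intro sep) auto
    then show False using l(2) lz[of \<phi>] by (simp add: blinfun.zero_right)
  qed
  then obtain w where w: "w \<in> W" "dist (s w) (s \<phi>) < e" using e by (auto simp: closure_approachable)
  have "\<bar>(w - \<phi>) (y n)\<bar> < e" for n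
  proof -
    have "\<bar>(w - \<phi>) (y n)\<bar> = dist (s w n) (s \<phi> n)" by (simp add: s blinfun.diff_left dist_real_def)
    also have "\<dots> \<le> dist (s w) (s \<phi>)" by (rule dist_bounded)
    finally show ?thesis using w(2) by linarith
  qed
  then show ?thesis using w(1) by blast
qed

text \<open>This replaces the Krein--Smulian theorem: the zero set of \<open>f\<close> is closed in the bounded
  weak-star topology, in which the weak-star dense subspace \<open>W\<close> is still dense.\<close>

theorem vanishing_on_separating_subspace:
  fixes f :: "('a::banach \<Rightarrow>\<^sub>L real) \<Rightarrow> real" and W :: "('a \<Rightarrow>\<^sub>L real) set"
  assumes cont: "\<And>R. continuous_on (dual_ball R) (\<lambda>u. f (Blinfun u))"
    and W: "subspace W" and sep: "\<And>x. (\<And>w. w \<in> W \<Longrightarrow> w x = 0) \<Longrightarrow> x = 0"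
    and f: "\<And>w. w \<in> W \<Longrightarrow> f w = 0"
  shows "f \<phi> = 0"
proof (rule ccontr)
  assume ne: "f \<phi> \<noteq> 0"
  let ?g = "\<lambda>u. f (Blinfun (\<lambda>x. u x + \<phi> x))"
  \<comment> \<open>The picture is translated by \<open>\<phi>\<close> to the origin: every
    \<open>u\<close> for which \<open>f\<close> vanishes at \<open>u + \<phi>\<close> lies in
    \<open>V\<close>, whereas \<open>u = 0\<close> does not.\<close>
  define V where "V = {u. \<bar>f \<phi>\<bar> \<le> \<bar>?g u - f \<phi>\<bar>}"
  have "compact (V \<inter> dual_ball R)" for R
  proof -
    \<comment> \<open>Translation stays within a larger ball, where \<open>cont\<close> applies;
      hence \<open>V\<close> is relatively closed in each compact ball.\<close>
    have "(\<lambda>u x. u x + \<phi> x) ` dual_ball R \<subseteq> dual_ball (R + norm \<phi>)"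
    proof (clarsimp simp: dual_ball_def)
      fix u :: "'a \<Rightarrow> real" assume u: "linear u" "\<forall>x. \<bar>u x\<bar> \<le> R * norm x"
      have "\<bar>u x + \<phi> x\<bar> \<le> (R + norm \<phi>) * norm x" for x
        using u(2)[rule_format, of x] norm_blinfun[of \<phi> x] abs_triangle_ineq[of "u x" "\<phi> x"]
        by (simp add: algebra_simps)
      moreover have "linear (\<lambda>x. u x + \<phi> x)"
        by (intro linear_compose_add u(1) bounded_linear.linear blinfun.bounded_linear_right)
      ultimately show "linear (\<lambda>x. u x + \<phi> x) \<and> (\<forall>x. \<bar>u x + \<phi> x\<bar> \<le> (R + norm \<phi>) * norm x)" by blast
    qed
    moreover have "continuous_on (dual_ball R) (\<lambda>u x. u x + \<phi> x)"
      by (intro continuous_on_coordinatewise_then_product continuous_intros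
          continuous_on_subset[OF continuous_on_product_coordinates]) auto
    ultimately have "continuous_on (dual_ball R) ?g"
      by (intro continuous_on_compose2[OF cont])
    then have "continuous_on (dual_ball R) (\<lambda>u. \<bar>?g u - f \<phi>\<bar>)" by (intro continuous_intros)
    then have "closed (dual_ball R \<inter> (\<lambda>u. \<bar>?g u - f \<phi>\<bar>) -` {\<bar>f \<phi>\<bar>..})"
      by (intro continuous_closed_preimage closed_dual_ball closed_atLeast)
    then have "compact (dual_ball R \<inter> (dual_ball R \<inter> (\<lambda>u. \<bar>?g u - f \<phi>\<bar>) -` {\<bar>f \<phi>\<bar>..}))"
      by (intro compact_Int_closed Banach_Alaoglu)
    moreover have "dual_ball R \<inter> (dual_ball R \<inter> (\<lambda>u. \<bar>?g u - f \<phi>\<bar>) -` {\<bar>f \<phi>\<bar>..}) = V \<inter> dual_ball R"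
      by (auto simp: V_def)
    ultimately show ?thesis by simp
  qed
  moreover have "(\<lambda>x. 0) \<notin> V" using ne by (simp add: V_def blinfun_apply_inverse)
  ultimately obtain y :: "nat \<Rightarrow> 'a" where y: "y \<longlonglongrightarrow> 0"
    "\<And>u R. u \<in> V \<Longrightarrow> u \<in> dual_ball R \<Longrightarrow> \<exists>n. \<bar>u (y n)\<bar> > 1"
    using Banach_Dieudonne[of V] by blast
  obtain w where w: "w \<in> W" "\<And>n. \<bar>(w - \<phi>) (y n)\<bar> < 1"
    using separating_subspace_dense_on_null_sequence[OF W sep y(1), of 1 \<phi>] by auto
  have "blinfun_apply (w - \<phi>) \<in> V"
    using f[OF w(1)] by (simp add: V_def blinfun.diff_left blinfun_apply_inverse)
  then obtain n where "\<bar>(w - \<phi>) (y n)\<bar> > 1" using y(2) blinfun_in_dual_ball by blast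
  then show False using w(2)[of n] by linarith
qed

subsection \<open>Free Banach lattices\<close>

text \<open>The functions with this continuity form a closed sublattice containing the evaluations.
  It is closed because a function of small norm is uniformly small on each ball, by
  \<open>fbl_abs_le_norm\<close>, and uniform limits preserve continuity.\<close>

lemma FBL_continuous_on_dual_ball:
  fixes f :: "('e::real_normed_vector \<Rightarrow>\<^sub>L real) \<Rightarrow> real"
  assumes p: "1 \<le> p" and f: "f \<in> FBL p"
  shows "continuous_on (dual_ball R) (\<lambda>u. f (Blinfun u))"
proof -
  \<comment> \<open>Nonnegative radii are used so that \<open>dual_ball_Blinfun\<close> applies; a
    general \<open>R\<close> is covered at the end by the ball of radius
    \<open>max 0 R\<close>.\<close>
  define L :: "(('e \<Rightarrow>\<^sub>L real) \<Rightarrow> real) set" where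
    "L = {f \<in> fbl_H p. \<forall>R\<ge>0. continuous_on (dual_ball R) (\<lambda>u. f (Blinfun u))}"
  note clH = fbl_closed_sublatticeD[OF fbl_H_closed_sublattice[OF p, where 'e='e]]
  have "fbl_closed_sublattice p L"
    unfolding fbl_closed_sublattice_def
  proof (intro conjI ballI allI impI)
    show "L \<subseteq> fbl_H p" by (auto simp: L_def)
    show "(\<lambda>\<phi>. 0) \<in> L" using clH(2) by (simp add: L_def)
    fix f assume f: "f \<in> L"
    show "(\<lambda>\<phi>. c * f \<phi>) \<in> L" for c
      using f by (auto simp: L_def clH(4) intro!: continuous_intros)
    fix g assume g: "g \<in> L"
    show "(\<lambda>\<phi>. f \<phi> + g \<phi>) \<in> L"
      using f g by (auto simp: L_def clH(3) intro!: continuous_intros)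
    show "(\<lambda>\<phi>. max (f \<phi>) (g \<phi>)) \<in> L"
      using f g by (auto simp: L_def clH(5) intro!: continuous_intros)
    show "(\<lambda>\<phi>. min (f \<phi>) (g \<phi>)) \<in> L"
      using f g by (auto simp: L_def clH(6) intro!: continuous_intros)
  next
    fix f assume f: "f \<in> fbl_H p" "\<forall>e>0. \<exists>g\<in>L. fbl_norm p (\<lambda>\<phi>. f \<phi> - g \<phi>) < ennreal e"
    have "\<forall>n. \<exists>g\<in>L. fbl_norm p (\<lambda>\<phi>. f \<phi> - g \<phi>) < ennreal (1 / real (Suc n))"
      using f(2) by simp
    then obtain g where g: "\<And>n. g n \<in> L"
      "\<And>n. fbl_norm p (\<lambda>\<phi>. f \<phi> - g n \<phi>) < ennreal (1 / real (Suc n))" by metis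
    have "continuous_on (dual_ball R) (\<lambda>u. f (Blinfun u))" if R: "0 \<le> R" for R
    proof (rule uniform_limit_theorem)
      show "\<forall>\<^sub>F n in sequentially. continuous_on (dual_ball R) (\<lambda>u. g n (Blinfun u))"
        using g(1) R by (simp add: L_def)
      have bound: "\<bar>f (Blinfun u) - g n (Blinfun u)\<bar> \<le> R * (1 / real (Suc n))"
        if "u \<in> dual_ball R" for u :: "'e \<Rightarrow> real" and n
      proof -
        have "f \<in> pos_homogeneous" "g n \<in> pos_homogeneous"
          using f(1) g(1)[of n] by (auto simp: L_def fbl_H_def)
        then have "(\<lambda>\<phi>. f \<phi> - g n \<phi>) \<in> pos_homogeneous"
          by (auto simp: pos_homogeneous_def algebra_simps)
        then have "ennreal \<bar>f (Blinfun u) - g n (Blinfun u)\<bar>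
            \<le> ennreal (norm (Blinfun u)) * fbl_norm p (\<lambda>\<phi>. f \<phi> - g n \<phi>)"
          by (rule fbl_abs_le_norm[OF p])
        also have "\<dots> \<le> ennreal R * ennreal (1 / real (Suc n))"
          using dual_ball_Blinfun(2)[OF that R] g(2)[of n]
          by (intro mult_mono ennreal_leI) auto
        also have "\<dots> = ennreal (R * (1 / real (Suc n)))" using R by (intro ennreal_mult[symmetric]) simp_all
        finally show ?thesis using R by (simp add: ennreal_le_iff)
      qed
      have lim: "(\<lambda>n. R * (1 / real (Suc n))) \<longlonglongrightarrow> 0"
        using tendsto_mult_right[OF LIMSEQ_inverse_real_of_nat, of R] by (simp add: inverse_eq_divide)
      show "uniform_limit (dual_ball R) (\<lambda>n u. g n (Blinfun u)) (\<lambda>u. f (Blinfun u)) sequentially"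
      proof (rule uniform_limitI)
        fix e :: real assume "0 < e"
        with lim have "\<forall>\<^sub>F n in sequentially. R * (1 / real (Suc n)) < e"
          by (rule order_tendstoD)
        then show "\<forall>\<^sub>F n in sequentially. \<forall>u\<in>dual_ball R. dist (g n (Blinfun u)) (f (Blinfun u)) < e"
        proof eventually_elim
          case (elim n)
          show ?case
          proof
            fix u :: "'e \<Rightarrow> real" assume "u \<in> dual_ball R"
            then show "dist (g n (Blinfun u)) (f (Blinfun u)) < e"
              using bound[of u n] elim by (simp add: dist_real_def abs_minus_commute)
          qed
        qed
      qed
    qed simp
    then show "f \<in> L" using f(1) by (simp add: L_def)
  qed
  moreover have "range fbl_delta \<subseteq> L"
  proof -
    have "continuous_on (dual_ball R) (\<lambda>u. fbl_delta x (Blinfun u))" if "0 \<le> R" for R and x :: 'e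
    proof -
      have "continuous_on (dual_ball R) (\<lambda>u. u x)"
        by (rule continuous_on_subset[OF continuous_on_product_coordinates]) simp
      then show ?thesis
        by (rule continuous_on_eq) (simp add: fbl_delta_def dual_ball_Blinfun(1)[OF _ that])
    qed
    then show ?thesis using fbl_delta_in_H[OF p] by (auto simp: L_def)
  qed
  ultimately have "FBL p \<subseteq> L" by (rule FBL_minimal)
  then have "continuous_on (dual_ball (max 0 R)) (\<lambda>u. f (Blinfun u))" using f by (auto simp: L_def)
  then show ?thesis by (rule continuous_on_subset) (rule dual_ball_mono, simp)
qed

lemma FBL_eqI:
  fixes f g :: "('f::banach \<Rightarrow>\<^sub>L real) \<Rightarrow> real"
  assumes p: "1 \<le> p" and fg: "f \<in> FBL p" "g \<in> FBL p"
    and W: "subspace W" and sep: "\<And>x. (\<And>w. w \<in> W \<Longrightarrow> blinfun_apply w x = 0) \<Longrightarrow> x = 0"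
    and eq: "\<And>w. w \<in> W \<Longrightarrow> f w = g w"
  shows "f = g"
proof
  fix \<phi>
  have "(\<lambda>\<phi>. f \<phi> - g \<phi>) \<in> FBL p" by (rule FBL_D(5)[OF p fg])
  from FBL_continuous_on_dual_ball[OF p this] have "f \<phi> - g \<phi> = 0"
    by (rule vanishing_on_separating_subspace[OF _ W sep]) (simp_all add: eq)
  then show "f \<phi> = g \<phi>" by simp
qed

theorem proposition6:
  fixes T :: "'f::banach \<Rightarrow>\<^sub>L 'e::banach" and p :: ennreal
  assumes "1 \<le> p"
  shows "inj (blinfun_apply T) \<longleftrightarrow> inj_on (fbl_ext p T) (FBL p)"
proof
  assume inj: "inj (blinfun_apply T)"
  let ?W = "range (\<lambda>\<psi> :: 'e \<Rightarrow>\<^sub>L real. \<psi> o\<^sub>L T)"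
  have "linear (\<lambda>\<psi> :: 'e \<Rightarrow>\<^sub>L real. \<psi> o\<^sub>L T)"
    by (intro linearI blinfun_eqI) (simp_all add: blinfun.add_left blinfun.scaleR_left)
  then have W: "subspace ?W" by (rule linear_subspace_image) simp
  \<comment> \<open>If the range of the adjoint vanishes at \<open>x\<close>, every functional
    vanishes at \<open>T x\<close>; so \<open>T x = 0\<close>, and injectivity gives
    \<open>x = 0\<close>.\<close>
  have sep: "x = 0" if "\<And>w. w \<in> ?W \<Longrightarrow> blinfun_apply w x = 0" for x
  proof -
    have "blinfun_apply \<psi> (blinfun_apply T x) = 0" for \<psi> :: "'e \<Rightarrow>\<^sub>L real"
      using that[of "\<psi> o\<^sub>L T"] by simp
    then have "blinfun_apply T x = blinfun_apply T 0"
      by (simp add: dual_separates_points blinfun.zero_right)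
    then show ?thesis by (rule injD[OF inj])
  qed
  show "inj_on (fbl_ext p T) (FBL p)"
  proof (rule inj_onI)
    fix f g :: "('f \<Rightarrow>\<^sub>L real) \<Rightarrow> real"
    assume f: "f \<in> FBL p" and g: "g \<in> FBL p" and eq: "fbl_ext p T f = fbl_ext p T g"
    show "f = g"
    proof (rule FBL_eqI[OF assms f g W])
      fix w assume "w \<in> ?W"
      then obtain \<psi> :: "'e \<Rightarrow>\<^sub>L real" where w: "w = \<psi> o\<^sub>L T" by blast
      \<comment> \<open>The value of \<open>fbl_ext p T f\<close> at \<open>\<psi>\<close> is
        \<open>f (\<psi> o\<^sub>L T)\<close>, so equal images mean agreement on
        \<open>?W\<close>.\<close>
      show "f w = g w"
        using fun_cong[OF eq, of \<psi>] unfolding fbl_ext_apply[OF assms f] fbl_ext_apply[OF assms g] w .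
    qed (rule sep)
  qed
next
  assume inj: "inj_on (fbl_ext p T) (FBL p)"
  show "inj (blinfun_apply T)"
  proof (rule injI)
    fix x y assume xy: "blinfun_apply T x = blinfun_apply T y"
    \<comment> \<open>For the converse, \<open>T\<close> is recovered from the extension on
      evaluations, and \<open>fbl_delta\<close> is injective because the dual separates
      points.\<close>
    have ext: "fbl_ext p T (fbl_delta z) = fbl_delta (blinfun_apply T z)" for z
      using fbl_ext_apply[OF assms fbl_delta_in_FBL, of T z] by (simp add: fbl_delta_def)
    have eq: "fbl_delta x = fbl_delta y"
      by (rule inj_onD[OF inj _ fbl_delta_in_FBL fbl_delta_in_FBL]) (simp only: ext xy)
    have "blinfun_apply \<phi> (x - y) = 0" for \<phi> :: "'f \<Rightarrow>\<^sub>L real"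
      using fun_cong[OF eq, of \<phi>] by (simp add: fbl_delta_def blinfun.diff_right)
    then show "x = y" using dual_separates_points[of "x - y"] by simp
  qed
qed

end
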